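(* Let $(\mathcal{C},\lambda)$ be a $(2n+1)$-dimensional contact manifold with canonical coordinates $(x,p,z)$, $\lambda=dz-p_a\,dx^a$, let $\varphi$ be a function of $p$ only, let $F_1,\dots,F_n$ be functions of $p$ that do not identically vanish, and let $\gamma^0$ be a non-zero constant. Let $X_h$ be the contact Hamiltonian vector field associated to $$h(x,p,z)=\Big(x^a-\frac{\partial\varphi}{\partial p_a}(p)\Big)F_a(p)+\gamma^0\,(x^jp_j-\varphi(p)-z),$$ considered for initial conditions with $h(x(0),p(0),z(0))>0$, i.e. on the region $\{h>0\}$. Then, within the class of densities depending on $(x,p,z)$ only through $h$, an invariant measure for $X_h$ is $$\Omega^{\mathrm{Inv}}=f^{\mathrm{Inv}}\,\Omega_\lambda,\qquad f^{\mathrm{Inv}}=\frac{1}{Z}\,h^{-(n+1)},$$ where $Z$ is a non-zero constant.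
   Context: All objects are smooth and repeated indices are summed over $1,\dots,n$. The standard volume form is $\Omega_\lambda=\lambda\wedge\underbrace{d\lambda\wedge\dots\wedge d\lambda}_{n}$. An invariant measure for a vector field $X$ is a non-vanishing top-degree form $\Omega$ with $\partial\Omega/\partial t=0$ (no explicit time dependence) and $\mathcal{L}_X\Omega=0$, where $\mathcal{L}_X$ is the Lie derivative. The contact Hamiltonian vector field $X_h$ of a function $h$ is defined by $\iota_{X_h}\lambda=h$, $\iota_{X_h}d\lambda=-(dh-(\mathcal{R}h)\lambda)$ with $\mathcal{R}=\partial/\partial z$; in coordinates $\dot x^a=-\partial h/\partial p_a$, $\dot p_a=\partial h/\partial x^a+p_a\,\partial h/\partial z$, $\dot z=h-p_a\,\partial h/\partial p_a$. *)

theory Defs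
  imports "HOL-Analysis.Analysis" "HOL-Combinatorics.Permutations"
begin

section \<open>Smooth functions on open subsets of Euclidean spaces\<close>

fun C_diff_on :: "nat \<Rightarrow> 'a::real_normed_vector set \<Rightarrow> ('a \<Rightarrow> 'b::real_normed_vector) \<Rightarrow> bool" where
  "C_diff_on 0 S f \<longleftrightarrow> continuous_on S f"
| "C_diff_on (Suc k) S f \<longleftrightarrow>
     (\<forall>x\<in>S. f differentiable (at x)) \<and>
     (\<forall>v. C_diff_on k S (\<lambda>x. frechet_derivative f (at x) v))"

text \<open>Only used for open \<open>S\<close> in a finite-dimensional space, where \<open>C_diff_on k\<close> is the class $C^k$.\<close>
definition smooth_on :: "'a::real_normed_vector set \<Rightarrow> ('a \<Rightarrow> 'b::real_normed_vector) \<Rightarrow> bool" where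
  "smooth_on S f \<longleftrightarrow> (\<forall>k. C_diff_on k S f)"

section \<open>Differential forms on open subsets of a Euclidean space\<close>

text \<open>A form of degree \<open>k\<close> takes a point \<open>y\<close> and a sequence \<open>v\<close> of tangent vectors, of which only
  \<open>v 0, \<dots>, v (k - 1)\<close> matter. Since the degree is not part of the type, operations that need it
  take it as an argument.\<close>
type_synonym 'v dform = "'v \<Rightarrow> (nat \<Rightarrow> 'v) \<Rightarrow> real"

definition alternating_form :: "nat \<Rightarrow> ((nat \<Rightarrow> 'v::real_vector) \<Rightarrow> real) \<Rightarrow> bool" where
  "alternating_form k \<alpha> \<longleftrightarrow>
     (\<forall>v w. (\<forall>i<k. v i = w i) \<longrightarrow> \<alpha> v = \<alpha> w) \<and>
     (\<forall>v. \<forall>i<k. linear (\<lambda>u. \<alpha> (v(i := u)))) \<and>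
     (\<forall>v. \<forall>i<k. \<forall>j<k. i \<noteq> j \<and> v i = v j \<longrightarrow> \<alpha> v = 0)"

definition diff_form_on :: "nat \<Rightarrow> 'v::real_normed_vector set \<Rightarrow> 'v dform \<Rightarrow> bool" where
  "diff_form_on k S \<omega> \<longleftrightarrow>
     (\<forall>y\<in>S. alternating_form k (\<omega> y)) \<and> (\<forall>v. smooth_on S (\<lambda>y. \<omega> y v))"

definition zero_form :: "('v \<Rightarrow> real) \<Rightarrow> 'v dform" where
  "zero_form f = (\<lambda>y v. f y)"

text \<open>Normalised so that $(\alpha\wedge\beta)(u,v) = \alpha(u)\beta(v) - \alpha(v)\beta(u)$ for
  1-forms; the exterior derivative below uses the matching convention.\<close>
definition wedge :: "nat \<Rightarrow> nat \<Rightarrow> 'v dform \<Rightarrow> 'v dform \<Rightarrow> 'v dform" where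
  "wedge k l \<alpha> \<beta> = (\<lambda>y v.
     (\<Sum>\<sigma> | \<sigma> permutes {..<k + l}.
        of_int (sign \<sigma>) * \<alpha> y (\<lambda>i. v (\<sigma> i)) * \<beta> y (\<lambda>i. v (\<sigma> (k + i)))) / (fact k * fact l))"

primrec wedge_power :: "nat \<Rightarrow> 'v dform \<Rightarrow> nat \<Rightarrow> 'v dform" where
  "wedge_power k \<omega> 0 = zero_form (\<lambda>y. 1)"
| "wedge_power k \<omega> (Suc m) = wedge k (m * k) \<omega> (wedge_power k \<omega> m)"

text \<open>$d\omega(v_0,\dots,v_k) = \sum_i (-1)^i\, D(\omega(v_0,\dots,\hat{v_i},\dots,v_k))\,v_i$ for
  constant vector fields \<open>v\<^sub>i\<close>, whose brackets vanish; \<open>\<lambda>j. v (if j < i then j else Suc j)\<close>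
  is \<open>v\<close> with its \<open>i\<close>-th entry omitted.\<close>
definition ext_deriv :: "nat \<Rightarrow> 'v::real_normed_vector dform \<Rightarrow> 'v dform" where
  "ext_deriv k \<omega> = (\<lambda>y v. \<Sum>i\<le>k. (- 1) ^ i *
     frechet_derivative (\<lambda>u. \<omega> u (\<lambda>j. v (if j < i then j else Suc j))) (at y) (v i))"

definition interior_product :: "('v \<Rightarrow> 'v) \<Rightarrow> 'v dform \<Rightarrow> 'v dform" where
  "interior_product X \<omega> = (\<lambda>y v. \<omega> y (case_nat (X y) v))"

definition lie_bracket :: "('v::real_normed_vector \<Rightarrow> 'v) \<Rightarrow> ('v \<Rightarrow> 'v) \<Rightarrow> 'v \<Rightarrow> 'v" where
  "lie_bracket X Y = (\<lambda>y.
     frechet_derivative Y (at y) (X y) - frechet_derivative X (at y) (Y y))"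

text \<open>$(\mathcal{L}_X\omega)(Y_1,\dots,Y_k) = X(\omega(Y_1,\dots,Y_k))
  - \sum_i \omega(Y_1,\dots,[X,Y_i],\dots,Y_k)$; both sides are tensorial in the \<open>Y\<^sub>i\<close>, so
  evaluating on constant vector fields suffices.\<close>
definition lie_derivative ::
  "nat \<Rightarrow> ('v::real_normed_vector \<Rightarrow> 'v) \<Rightarrow> 'v dform \<Rightarrow> 'v dform" where
  "lie_derivative k X \<omega> = (\<lambda>y v.
     frechet_derivative (\<lambda>u. \<omega> u v) (at y) (X y)
     - (\<Sum>i<k. \<omega> y (v(i := lie_bracket X (\<lambda>_. v i) y))))"

text \<open>\<open>\<Omega> t\<close> is the form at time \<open>t\<close>.\<close>
definition invariant_measure ::
  "'v::euclidean_space set \<Rightarrow> ('v \<Rightarrow> 'v) \<Rightarrow> (real \<Rightarrow> 'v dform) \<Rightarrow> bool" where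
  "invariant_measure S X \<Omega> \<longleftrightarrow> (\<forall>t.
     diff_form_on DIM('v) S (\<Omega> t) \<and>
     (\<forall>y\<in>S. \<exists>v. \<Omega> t y v \<noteq> 0) \<and>
     (\<forall>y\<in>S. \<forall>v. ((\<lambda>s. \<Omega> s y v) has_real_derivative 0) (at t)) \<and>
     (\<forall>y\<in>S. \<forall>v. lie_derivative DIM('v) X (\<Omega> t) y v = 0))"

section \<open>Contact geometry in canonical coordinates\<close>

text \<open>Points are \<open>(x, p, z)\<close>; the dimension \<open>n\<close> is \<open>CARD('n)\<close>.\<close>
type_synonym 'n contact_space = "(real ^ 'n) \<times> (real ^ 'n) \<times> real"

text \<open>$\lambda = dz - p_a\,dx^a$\<close>
definition contact_form :: "'n::finite contact_space dform" where
  "contact_form = (\<lambda>(x, p, z) v. case v 0 of (dx, dp, dz) \<Rightarrow> dz - (\<Sum>a\<in>UNIV. p $ a * dx $ a))"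

definition contact_volume :: "'n::finite contact_space dform" where
  "contact_volume = wedge 1 (CARD('n) * 2) contact_form
     (wedge_power 2 (ext_deriv 1 contact_form) CARD('n))"

text \<open>$\mathcal{R}h = \partial h/\partial z$\<close>
definition reeb_deriv :: "('n::finite contact_space \<Rightarrow> real) \<Rightarrow> 'n contact_space \<Rightarrow> real" where
  "reeb_deriv h y = frechet_derivative h (at y) (0, 0, 1)"

definition contact_hamiltonian_field ::
  "'n::finite contact_space set \<Rightarrow> ('n contact_space \<Rightarrow> real)
    \<Rightarrow> ('n contact_space \<Rightarrow> 'n contact_space) \<Rightarrow> bool" where
  "contact_hamiltonian_field S h X \<longleftrightarrow> (\<forall>y\<in>S. \<forall>v.
     interior_product X contact_form y v = h y \<and>
     interior_product X (ext_deriv 1 contact_form) y v =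
       - (ext_deriv 0 (zero_form h) y v - reeb_deriv h y * contact_form y v))"

definition partial_deriv :: "'n::finite \<Rightarrow> (real ^ 'n \<Rightarrow> real) \<Rightarrow> real ^ 'n \<Rightarrow> real" where
  "partial_deriv a \<phi> p = frechet_derivative \<phi> (at p) (axis a 1)"

lemma ext_deriv_contact_form:
  "ext_deriv 1 contact_form y v =
     (\<Sum>a\<in>UNIV. fst (v 0) $ a * fst (snd (v 1)) $ a - fst (snd (v 0)) $ a * fst (v 1) $ a)"
  (is "_ = ?r")
proof -
  have d: "frechet_derivative (\<lambda>u. contact_form u w) (at y) u =
      - (\<Sum>a\<in>UNIV. fst (snd u) $ a * fst (w 0) $ a)" for w u :: "_" and y :: "'a contact_space"
  proof -
    have eq: "(\<lambda>u. contact_form u w) =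
       (\<lambda>u::'a contact_space. snd (snd (w 0)) - (\<Sum>a\<in>UNIV. fst (snd u) $ a * fst (w 0) $ a))"
      by (auto simp: contact_form_def case_prod_beta fun_eq_iff)
    have c: "((\<lambda>u. fst (snd u) $ a) has_derivative (\<lambda>u. fst (snd u) $ a)) (at y)"
      for a :: 'a and y :: "'a contact_space"
      by (rule bounded_linear_imp_has_derivative)
        (simp add: linear_conv_bounded_linear[symmetric] linear_iff)
    have "((\<lambda>u. contact_form u w) has_derivative
        (\<lambda>u. - (\<Sum>a\<in>UNIV. fst (snd u) $ a * fst (w 0) $ a))) (at y)"
      unfolding eq by (auto intro!: derivative_eq_intros c simp: sum_negf)
    then show ?thesis
      by (simp add: frechet_derivative_at[symmetric])
  qed
  show ?thesis
    by (simp add: ext_deriv_def d atMost_Suc sum_subtractf mult.commute)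
qed

text \<open>Existence, uniqueness and the coordinate expression of the contact Hamiltonian vector
  field.\<close>
lemma contact_hamiltonian_field_coords:
  fixes h :: "'n::finite contact_space \<Rightarrow> real"
  assumes h: "\<And>y. y \<in> S \<Longrightarrow> h differentiable (at y)"
  shows "contact_hamiltonian_field S h X \<longleftrightarrow> (\<forall>(x, p, z)\<in>S.
     let D = frechet_derivative h (at (x, p, z));
         hx = (\<chi> a. D (axis a 1, 0, 0)); hp = (\<chi> a. D (0, axis a 1, 0)); hz = D (0, 0, 1)
     in X (x, p, z) = (- hp, hx + hz *\<^sub>R p, h (x, p, z) - (\<Sum>a\<in>UNIV. p $ a * hp $ a)))"
proof -
  have "(\<forall>v. interior_product X contact_form y v = h y \<and>
     interior_product X (ext_deriv 1 contact_form) y v =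
       - (ext_deriv 0 (zero_form h) y v - reeb_deriv h y * contact_form y v)) \<longleftrightarrow>
     X y = (- (\<chi> a. D (0, axis a 1, 0)), (\<chi> a. D (axis a 1, 0, 0)) + D (0, 0, 1) *\<^sub>R p,
        h y - (\<Sum>a\<in>UNIV. p $ a * D (0, axis a 1, 0)))" (is "?L \<longleftrightarrow> ?R")
    if y: "y \<in> S" "y = (x, p, z)" "D = frechet_derivative h (at y)" for y x p z D
  proof -
    have lin: "linear D"
      using h[OF y(1)] y(3) by (simp add: linear_frechet_derivative)
    obtain X1 X2 X3 where X: "X y = (X1, X2, X3)" by (cases "X y")
    have expand: "D (a, b, c) = (\<Sum>i\<in>UNIV. a $ i * D (axis i 1, 0, 0))
        + (\<Sum>i\<in>UNIV. b $ i * D (0, axis i 1, 0)) + c * D (0, 0, 1)" for a b c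
    proof -
      have 1: "(a, 0, 0) = (\<Sum>i\<in>UNIV. a $ i *\<^sub>R (axis i 1, 0::real^'n, 0::real))"
        by (simp add: prod_eq_iff fst_sum snd_sum)
           (metis (no_types, lifting) basis_expansion scalar_mult_eq_scaleR sum.cong)
      have 2: "(0, b, 0) = (\<Sum>i\<in>UNIV. b $ i *\<^sub>R (0::real^'n, axis i 1, 0::real))"
        by (simp add: prod_eq_iff fst_sum snd_sum)
           (metis (no_types, lifting) basis_expansion scalar_mult_eq_scaleR sum.cong)
      have 3: "(0, 0, c) = c *\<^sub>R (0::real^'n, 0::real^'n, 1::real)" by simp
      have "D (a, b, c) = D ((a, 0, 0) + (0, b, 0) + (0, 0, c))" by simp
      also have "\<dots> = D (a, 0, 0) + D (0, b, 0) + D (0, 0, c)"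
        by (simp only: linear_add[OF lin])
      also have "\<dots> = (\<Sum>i\<in>UNIV. a $ i * D (axis i 1, 0, 0))
        + (\<Sum>i\<in>UNIV. b $ i * D (0, axis i 1, 0)) + c * D (0, 0, 1)"
        unfolding 1 2 3 by (simp only: linear_sum[OF lin] linear_scale[OF lin] real_scaleR_def)
      finally show ?thesis .
    qed
    have L1: "interior_product X contact_form y v = X3 - (\<Sum>a\<in>UNIV. p $ a * X1 $ a)" for v
      by (simp add: interior_product_def contact_form_def y(2) X[unfolded y(2)])
    have L2: "interior_product X (ext_deriv 1 contact_form) y v =
        (\<Sum>a\<in>UNIV. X1 $ a * fst (snd (v 0)) $ a - X2 $ a * fst (v 0) $ a)" for v
      using ext_deriv_contact_form[of y "case_nat (X y) v"]
      by (simp add: interior_product_def X)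
    have R2: "- (ext_deriv 0 (zero_form h) y v - reeb_deriv h y * contact_form y v) =
        - D (v 0) + D (0, 0, 1) * (snd (snd (v 0)) - (\<Sum>a\<in>UNIV. p $ a * fst (v 0) $ a))" for v
      by (simp add: ext_deriv_def zero_form_def reeb_deriv_def contact_form_def y case_prod_beta)
    have main: "?L \<longleftrightarrow> X3 - (\<Sum>a\<in>UNIV. p $ a * X1 $ a) = h y \<and>
       (\<forall>a b c. (\<Sum>i\<in>UNIV. X1 $ i * b $ i - X2 $ i * a $ i) =
          - D (a, b, c) + D (0, 0, 1) * (c - (\<Sum>i\<in>UNIV. p $ i * a $ i)))"
    proof -
      have all: "(\<forall>v::nat \<Rightarrow> 'n contact_space. P (v 0)) \<longleftrightarrow> (\<forall>a b c. P (a, b, c))" for P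
        by (auto dest: spec[of _ "\<lambda>_. (_, _, _)"]) (metis prod.collapse)
      show ?thesis
        unfolding L1 L2 R2 all_conj_distrib
        by (subst all[where P = "\<lambda>w. (\<Sum>i\<in>UNIV. X1 $ i * fst (snd w) $ i - X2 $ i * fst w $ i) =
          - D w + D (0, 0, 1) * (snd (snd w) - (\<Sum>i\<in>UNIV. p $ i * fst w $ i))"]) simp
    qed
    show ?thesis
    proof
      assume ?L
      then have e1: "X3 - (\<Sum>a\<in>UNIV. p $ a * X1 $ a) = h y"
        and e2: "\<And>a b c. (\<Sum>i\<in>UNIV. X1 $ i * b $ i - X2 $ i * a $ i) =
          - D (a, b, c) + D (0, 0, 1) * (c - (\<Sum>i\<in>UNIV. p $ i * a $ i))"
        using main by blast+
      have ax: "(\<Sum>j\<in>UNIV. c j * axis i (1::real) $ j) = c i" for c and i :: 'n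
      proof -
        have "(\<Sum>j\<in>UNIV. c j * axis i (1::real) $ j) = (\<Sum>j\<in>UNIV. if j = i then c j else 0)"
          by (rule sum.cong) (auto simp: axis_def)
        then show ?thesis by simp
      qed
      have X1: "X1 $ i = - D (0, axis i 1, 0)" for i
        using e2[where a = 0 and b = "axis i 1" and c = 0] by (simp add: ax)
      have X2: "X2 $ i = D (axis i 1, 0, 0) + D (0, 0, 1) * p $ i" for i
        using e2[where a = "axis i 1" and b = 0 and c = 0] by (simp add: ax sum_negf)
      show ?R
        using e1 X1 X2 by (auto simp: X vec_eq_iff sum_negf)
    next
      assume ?R
      then have X1: "X1 $ i = - D (0, axis i 1, 0)"
        and X2: "X2 $ i = D (axis i 1, 0, 0) + D (0, 0, 1) * p $ i"
        and X3: "X3 = h y - (\<Sum>a\<in>UNIV. p $ a * D (0, axis a 1, 0))" for i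
        by (auto simp: X)
      have "(\<Sum>i\<in>UNIV. X1 $ i * b $ i - X2 $ i * a $ i) =
          - D (a, b, c) + D (0, 0, 1) * (c - (\<Sum>i\<in>UNIV. p $ i * a $ i))" for a b c
        unfolding expand[of a b c] X1 X2
        by (simp add: sum_negf sum.distrib sum_subtractf sum_distrib_left
            distrib_right distrib_left right_diff_distrib mult_ac)
      moreover have "X3 - (\<Sum>a\<in>UNIV. p $ a * X1 $ a) = h y"
        by (simp add: X1 X3 sum_negf)
      ultimately show ?L
        unfolding main by blast
    qed
  qed
  then show ?thesis
    unfolding contact_hamiltonian_field_def by (fastforce simp: Let_def)
qed

end

theory Submission
  imports Defs
begin

text \<open>The form $\lambda\wedge(d\lambda)^n$ equals $dz\wedge(d\lambda)^n$, hence has constant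
  coefficients, so $\mathcal{L}_{X_h}(f\,\Omega_\lambda) = (X_h(f) + f\,\mathrm{div}\,X_h)\,\Omega_\lambda$
  with the Euclidean divergence, because a derivation acts on alternating forms of top degree as
  multiplication by its trace. Inserting $X_h$ into both sides of
  $\iota_{X_h}d\lambda = -(dh - (\mathcal{R}h)\lambda)$ gives $X_h(h) = h\,\mathcal{R}h$. Here
  $\mathcal{R}h = -\gamma^0$ and $\mathrm{div}\,X_h = -(n+1)\gamma^0$, so that both terms cancel for
  $f = h^{-(n+1)}/Z$.\<close>

section \<open>Alternating forms\<close>

text \<open>The exponent comes from an Euler equation. For a density \<rho>(h) the factor X(f) + f
  div X becomes -\<open>\<gamma>0\<close> (h \<rho>'(h) + (n + 1) \<rho>(h)), and on s > 0 the
  equation s \<rho>'(s) + (n + 1) \<rho>(s) = 0 has exactly the constant multiples of s^(-(n+1)) as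
  solutions. The laborious facts concern the contact volume: that it does not depend on the point
  and that it vanishes nowhere. Its definition nests one sum over permutations per wedge factor, so
  these sums are merged into a single one. Equality of top-degree forms is then tested on one
  ordered basis, where such a form is determined. For non-vanishing, the signed terms of the sum
  might cancel; they do not when the x- and p-directions are listed in conjugate pairs, because then
  every term is non-negative.\<close>

lemma linear_cmult:
  fixes f :: "'a::real_vector \<Rightarrow> real"
  shows "linear f \<Longrightarrow> linear (\<lambda>x. c * f x)"
  using linear_compose_scale_right[of f c] by simp

lemma alternating_form_cong:
  "alternating_form k \<alpha> \<Longrightarrow> (\<And>i. i < k \<Longrightarrow> v i = w i) \<Longrightarrow> \<alpha> v = \<alpha> w"
  unfolding alternating_form_def by blast

lemma alternating_form_linear:
  "alternating_form k \<alpha> \<Longrightarrow> i < k \<Longrightarrow> linear (\<lambda>u. \<alpha> (v(i := u)))"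
  unfolding alternating_form_def by blast

lemma alternating_form_eq_0:
  "alternating_form k \<alpha> \<Longrightarrow> i < k \<Longrightarrow> j < k \<Longrightarrow> i \<noteq> j \<Longrightarrow> v i = v j \<Longrightarrow> \<alpha> v = 0"
  unfolding alternating_form_def by blast

text \<open>Polarisation: with \<open>v i + v j\<close> in both slots the form vanishes, as do the
  two diagonal terms of its expansion, so the two mixed terms are opposite.\<close>

lemma alternating_form_transpose:
  assumes \<alpha>: "alternating_form k \<alpha>" and ij: "i < k" "j < k" "i \<noteq> j"
  shows "\<alpha> (v \<circ> Transposition.transpose i j) = - \<alpha> v"
proof -
  define g where "g a b = \<alpha> (v(i := a, j := b))" for a b
  have g0: "g a a = 0" for a
    unfolding g_def by (rule alternating_form_eq_0[OF \<alpha> ij]) (use ij in auto)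
  have l2: "g a (b + c) = g a b + g a c" for a b c
    unfolding g_def by (rule linear_add[OF alternating_form_linear[OF \<alpha> ij(2)]])
  have l1: "g (b + c) a = g b a + g c a" for a b c
    using linear_add[OF alternating_form_linear[OF \<alpha> ij(1), of "v(j := a)"]]
    by (simp add: g_def fun_upd_twist[OF ij(3)])
  have "g (v i + v j) (v i + v j) = g (v i) (v j) + g (v j) (v i)"
    unfolding l1 l2 by (simp add: g0)
  then have "g (v j) (v i) = - g (v i) (v j)"
    unfolding g0 by linarith
  moreover have "v(i := v i, j := v j) = v"
    by simp
  moreover have "v(i := v j, j := v i) = v \<circ> Transposition.transpose i j"
    using ij by (auto simp: fun_eq_iff Transposition.transpose_def)
  ultimately show ?thesis
    by (simp add: g_def)
qed

section \<open>Antisymmetrisation and wedge products\<close>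

text \<open>Antisymmetrisation without the factor 1/k!, applied to an arbitrary \<open>G\<close>;
  the factorials of the wedge normalisation are thus tracked outside the sum.\<close>

definition alternate :: "nat \<Rightarrow> ((nat \<Rightarrow> 'v) \<Rightarrow> real) \<Rightarrow> (nat \<Rightarrow> 'v) \<Rightarrow> real" where
  "alternate k G v = (\<Sum>\<sigma> | \<sigma> permutes {..<k}. of_int (sign \<sigma>) * G (\<lambda>i. v (\<sigma> i)))"

lemma alternating_form_alternate:
  fixes G :: "(nat \<Rightarrow> 'v::real_vector) \<Rightarrow> real"
  assumes cong: "\<And>v w. (\<And>i. i < k \<Longrightarrow> v i = w i) \<Longrightarrow> G v = G w"
    and lin: "\<And>v i. i < k \<Longrightarrow> linear (\<lambda>u. G (v(i := u)))"
  shows "alternating_form k (alternate k G)"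
  unfolding alternating_form_def
proof (intro conjI allI impI)
  fix v w :: "nat \<Rightarrow> 'v" assume vw: "\<forall>i<k. v i = w i"
  show "alternate k G v = alternate k G w"
    unfolding alternate_def
  proof (rule sum.cong[OF refl])
    fix \<sigma> assume "\<sigma> \<in> {\<sigma>. \<sigma> permutes {..<k}}"
    then have "\<And>i. i < k \<Longrightarrow> \<sigma> i < k"
      using permutes_in_image by fastforce
    then show "of_int (sign \<sigma>) * G (\<lambda>i. v (\<sigma> i)) = of_int (sign \<sigma>) * G (\<lambda>i. w (\<sigma> i))"
      using vw by (simp add: cong[of "\<lambda>i. v (\<sigma> i)" "\<lambda>i. w (\<sigma> i)"])
  qed
next
  fix v :: "nat \<Rightarrow> 'v" and i assume i: "i < k"
  have "linear (\<lambda>u. G (\<lambda>j. (v(i := u)) (\<sigma> j)))" if s: "\<sigma> permutes {..<k}" for \<sigma>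
  proof -
    \<comment> \<open>Changing entry \<open>i\<close> of \<open>v\<close> changes exactly one entry
      of the permuted sequence, the one that \<sigma> sends to \<open>i\<close>.\<close>
    have "(\<lambda>j. (v(i := u)) (\<sigma> j)) = (\<lambda>j. v (\<sigma> j))(inv \<sigma> i := u)" for u
      using permutes_inverses[OF s] by (auto simp: fun_eq_iff)
    moreover have "inv \<sigma> i < k"
      using permutes_in_image[OF permutes_inv[OF s], of i] i by simp
    ultimately show ?thesis
      using lin by simp
  qed
  then show "linear (\<lambda>u. alternate k G (v(i := u)))"
    unfolding alternate_def
    by (intro linear_compose_sum ballI linear_cmult) simp
next
  fix v :: "nat \<Rightarrow> 'v" and i j assume i: "i < k" and j: "j < k" and ij: "i \<noteq> j \<and> v i = v j"
  \<comment> \<open>Replacing \<sigma> by \<open>t \<circ> \<sigma>\<close> reverses the sign but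
    not the value of \<open>G\<close>, as \<open>v\<close> is equal at \<open>i\<close> and
    \<open>j\<close>. Hence the sum is its own negative.\<close>
  define t where "t = Transposition.transpose i j"
  have t: "t permutes {..<k}"
    unfolding t_def using i j by (intro permutes_swap_id) auto
  have vt: "v (t x) = v x" for x
    using ij by (auto simp: t_def Transposition.transpose_def)
  have "alternate k G v = (\<Sum>\<sigma> | \<sigma> permutes {..<k}. of_int (sign (t \<circ> \<sigma>)) * G (\<lambda>x. v ((t \<circ> \<sigma>) x)))"
    unfolding alternate_def by (rule setum_permutations_compose_left[OF t])
  also have "\<dots> = (\<Sum>\<sigma> | \<sigma> permutes {..<k}. - (of_int (sign \<sigma>) * G (\<lambda>x. v (\<sigma> x))))"
  proof (rule sum.cong[OF refl])
    fix \<sigma> assume "\<sigma> \<in> {\<sigma>. \<sigma> permutes {..<k}}"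
    then have "sign (t \<circ> \<sigma>) = - sign \<sigma>"
      using t ij by (subst sign_compose)
        (auto intro: permutes_imp_permutation[of "{..<k}"] simp: t_def sign_swap_id)
    then show "of_int (sign (t \<circ> \<sigma>)) * G (\<lambda>x. v ((t \<circ> \<sigma>) x)) = - (of_int (sign \<sigma>) * G (\<lambda>x. v (\<sigma> x)))"
      by (simp add: vt)
  qed
  also have "\<dots> = - alternate k G v"
    by (simp add: alternate_def sum_negf)
  finally show "alternate k G v = 0" by simp
qed

lemma wedge_eq_alternate:
  "wedge k l \<alpha> \<beta> y v = alternate (k + l) (\<lambda>v. \<alpha> y v * \<beta> y (\<lambda>i. v (k + i))) v / (fact k * fact l)"
  by (simp add: wedge_def alternate_def mult.assoc)

lemma alternating_form_cmult:
  assumes "alternating_form k \<alpha>"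
  shows "alternating_form k (\<lambda>v. c * \<alpha> v)"
  unfolding alternating_form_def
proof (intro conjI allI impI)
  show "c * \<alpha> v = c * \<alpha> w" if "\<forall>i<k. v i = w i" for v w
    using alternating_form_cong[OF assms, of v w] that by simp
  show "linear (\<lambda>u. c * \<alpha> (v(i := u)))" if "i < k" for v i
    by (rule linear_cmult[OF alternating_form_linear[OF assms that]])
  show "c * \<alpha> v = 0" if "i < k" "j < k" "i \<noteq> j \<and> v i = v j" for v i j
    using alternating_form_eq_0[OF assms that(1,2)] that(3) by simp
qed

text \<open>Before antisymmetrisation, each slot enters only one of the two factors: the first
  \<open>k\<close> slots enter \<alpha>, the others \<beta>. So the product is linear in each
  slot.\<close>

lemma alternating_form_wedge:
  assumes a: "alternating_form k (\<alpha> y)" and b: "alternating_form l (\<beta> y)"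
  shows "alternating_form (k + l) (wedge k l \<alpha> \<beta> y)"
proof -
  have "alternating_form (k + l) (alternate (k + l) (\<lambda>v. \<alpha> y v * \<beta> y (\<lambda>i. v (k + i))))"
  proof (rule alternating_form_alternate)
    fix v w :: "nat \<Rightarrow> 'a" assume "\<And>i. i < k + l \<Longrightarrow> v i = w i"
    then show "\<alpha> y v * \<beta> y (\<lambda>i. v (k + i)) = \<alpha> y w * \<beta> y (\<lambda>i. w (k + i))"
      by (intro arg_cong2[where f = "(*)"] alternating_form_cong[OF a] alternating_form_cong[OF b]) auto
  next
    fix v :: "nat \<Rightarrow> 'a" and i assume i: "i < k + l"
    show "linear (\<lambda>u. \<alpha> y (v(i := u)) * \<beta> y (\<lambda>j. (v(i := u)) (k + j)))"
    proof (cases "i < k")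
      case True
      then have "(\<lambda>j. (v(i := u)) (k + j)) = (\<lambda>j. v (k + j))" for u by auto
      then show ?thesis
        using linear_cmult[OF alternating_form_linear[OF a True, of v], of "\<beta> y (\<lambda>j. v (k + j))"]
        by (simp add: mult.commute)
    next
      case False
      then have "(\<lambda>j. (v(i := u)) (k + j)) = (\<lambda>j. v (k + j))(i - k := u)" for u
        by (auto simp: fun_eq_iff)
      moreover have "\<alpha> y (v(i := u)) = \<alpha> y v" for u
        by (rule alternating_form_cong[OF a]) (use False in auto)
      ultimately show ?thesis
        using linear_cmult[OF alternating_form_linear[OF b, of "i - k" "\<lambda>j. v (k + j)"], of "\<alpha> y v"] False i
        by simp
    qed
  qed
  from alternating_form_cmult[OF this, of "1 / (fact k * fact l)"] show ?thesis
    by (simp add: wedge_eq_alternate[abs_def] field_simps)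
qed

text \<open>The outer antisymmetrisation absorbs the inner one: each of the \<open>fact l\<close>
  inner permutations contributes the same full sum, which cancels the \<open>fact l\<close> in the
  wedge normalisation. The factor \<open>fact k\<close> stays because \<alpha> itself is not written
  as an antisymmetrisation.\<close>

lemma wedge_alternate:
  assumes cong: "\<And>v w. (\<And>i. i < k \<Longrightarrow> v i = w i) \<Longrightarrow> \<alpha> y v = \<alpha> y w"
    and \<beta>: "\<And>v. \<beta> y v = c * alternate l G v"
  shows "wedge k l \<alpha> \<beta> y v = c / fact k * alternate (k + l) (\<lambda>v. \<alpha> y v * G (\<lambda>i. v (k + i))) v"
proof -
  \<comment> \<open>\<open>E \<tau>\<close> fixes the first \<open>k\<close> indices and acts as
    \<tau> on the following block of length \<open>l\<close>. Substituting
    \<open>\<sigma> \<circ> E \<tau>\<close> for \<sigma> then removes \<tau> from the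
    summand.\<close>
  define E where "E \<tau> = map_permutation {..<l} ((+) k) \<tau>" for \<tau>
  have bij: "bij_betw ((+) k) {..<l} {k..<k + l}"
    by (simp add: bij_betw_def lessThan_atLeast0 add.commute)
  have E: "E \<tau> permutes {..<k + l}" "sign (E \<tau>) = sign \<tau>"
     "\<And>i. i < k \<Longrightarrow> E \<tau> i = i" "\<And>i. E \<tau> (k + i) = k + \<tau> i"
    if t: "\<tau> permutes {..<l}" for \<tau>
  proof -
    have p: "E \<tau> permutes {k..<k + l}"
      unfolding E_def by (rule map_permutation_permutes[OF bij t])
    show "E \<tau> permutes {..<k + l}"
      by (rule permutes_subset[OF p]) auto
    show "sign (E \<tau>) = sign \<tau>"
      unfolding E_def by (rule sign_map_permutation) (use t in auto)
    show "E \<tau> i = i" if "i < k" for i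
      by (rule permutes_not_in[OF p]) (use that in auto)
    show "E \<tau> (k + i) = k + \<tau> i" for i
    proof (cases "i < l")
      case True
      then show ?thesis unfolding E_def by (subst map_permutation_apply) auto
    next
      case False
      then show ?thesis using permutes_not_in[OF p, of "k + i"] permutes_not_in[OF t, of i] by simp
    qed
  qed
  define H where "H = (\<lambda>\<sigma>. of_int (sign \<sigma>) * (\<alpha> y (\<lambda>i. v (\<sigma> i)) * G (\<lambda>i. v (\<sigma> (k + i)))))"
  have "(\<Sum>\<sigma> | \<sigma> permutes {..<k + l}. of_int (sign \<sigma>) * (\<alpha> y (\<lambda>i. v (\<sigma> i)) *
        alternate l G (\<lambda>i. v (\<sigma> (k + i))))) =
      (\<Sum>\<sigma> | \<sigma> permutes {..<k + l}. \<Sum>\<tau> | \<tau> permutes {..<l}. H (\<sigma> \<circ> E \<tau>))"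
    unfolding alternate_def sum_distrib_left
  proof (intro sum.cong refl)
    fix \<sigma> \<tau> assume s: "\<sigma> \<in> {\<sigma>. \<sigma> permutes {..<k + l}}" and "\<tau> \<in> {\<tau>. \<tau> permutes {..<l}}"
    then have t: "\<tau> permutes {..<l}" by simp
    have "sign (\<sigma> \<circ> E \<tau>) = sign \<sigma> * sign \<tau>"
      using s E(1,2)[OF t]
      by (subst sign_compose) (auto intro: permutes_imp_permutation[of "{..<k + l}"])
    moreover have "\<alpha> y (\<lambda>i. v (\<sigma> i)) = \<alpha> y (\<lambda>i. v ((\<sigma> \<circ> E \<tau>) i))"
      by (rule cong) (simp add: E(3)[OF t])
    ultimately show "of_int (sign \<sigma>) * (\<alpha> y (\<lambda>i. v (\<sigma> i)) *
        (of_int (sign \<tau>) * G (\<lambda>i. v (\<sigma> (k + \<tau> i))))) = H (\<sigma> \<circ> E \<tau>)"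
      by (simp add: H_def E(4)[OF t])
  qed
  also have "\<dots> = (\<Sum>\<tau> | \<tau> permutes {..<l}. \<Sum>\<sigma> | \<sigma> permutes {..<k + l}. H (\<sigma> \<circ> E \<tau>))"
    by (rule sum.swap)
  also have "\<dots> = (\<Sum>\<tau> | \<tau> permutes {..<l}. sum H {\<sigma>. \<sigma> permutes {..<k + l}})"
    by (intro sum.cong refl sum_permutations_compose_right[symmetric]) (use E(1) in auto)
  also have "\<dots> = fact l * sum H {\<sigma>. \<sigma> permutes {..<k + l}}"
    by (simp add: card_permutations)
  finally have eq: "(\<Sum>\<sigma> | \<sigma> permutes {..<k + l}. of_int (sign \<sigma>) * (\<alpha> y (\<lambda>i. v (\<sigma> i)) *
        alternate l G (\<lambda>i. v (\<sigma> (k + i))))) = fact l * sum H {\<sigma>. \<sigma> permutes {..<k + l}}" .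
  have "wedge k l \<alpha> \<beta> y v = c * (\<Sum>\<sigma> | \<sigma> permutes {..<k + l}. of_int (sign \<sigma>) * (\<alpha> y (\<lambda>i. v (\<sigma> i)) *
        alternate l G (\<lambda>i. v (\<sigma> (k + i))))) / (fact k * fact l)"
    by (simp add: wedge_def \<beta> sum_distrib_left mult_ac)
  then show ?thesis
    unfolding eq by (simp add: alternate_def H_def)
qed

text \<open>Each factor 1/2 is the \<open>fact 2\<close> of one wedge with a 2-form; the factorials
  of the inner degrees have been absorbed.\<close>

lemma wedge_power_2_eq_alternate:
  assumes cong: "\<And>v w. (\<And>i. i < 2 \<Longrightarrow> v i = w i) \<Longrightarrow> \<beta> y v = \<beta> y w"
  shows "wedge_power 2 \<beta> m y v =
    (1 / 2) ^ m * alternate (m * 2) (\<lambda>v. \<Prod>i<m. \<beta> y (\<lambda>j. v (2 * i + j))) v"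
proof (induction m arbitrary: v)
  case 0
  then show ?case by (simp add: zero_form_def alternate_def)
next
  case (Suc m)
  have "wedge_power 2 \<beta> (Suc m) y v = (1 / 2) ^ m / fact 2 *
     alternate (2 + m * 2) (\<lambda>v. \<beta> y v * (\<Prod>i<m. \<beta> y (\<lambda>j. v (2 + (2 * i + j))))) v"
    unfolding wedge_power.simps by (rule wedge_alternate[where \<beta> = "wedge_power 2 \<beta> m", OF _ Suc.IH]) (rule cong)
  then show ?case
    by (simp add: prod.lessThan_Suc_shift fact_2 add.assoc del: prod.lessThan_Suc)
qed

lemma alternating_form_wedge_power:
  assumes "alternating_form k (\<omega> y)"
  shows "alternating_form (m * k) (wedge_power k \<omega> m y)"
proof (induction m)
  case 0
  then show ?case by (simp add: alternating_form_def zero_form_def)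
next
  case (Suc m)
  then show ?case
    using alternating_form_wedge[where \<alpha> = \<omega> and \<beta> = "wedge_power k \<omega> m" and y = y, OF assms] by simp
qed

section \<open>Alternating forms of top degree\<close>

text \<open>The space of top-degree forms has dimension at most one. By multilinearity only
  sequences of basis vectors matter; such a sequence either repeats a vector or is a permutation of
  \<open>b\<close>.\<close>

lemma alternating_top_form_eq_0:
  fixes \<omega> :: "(nat \<Rightarrow> 'v::euclidean_space) \<Rightarrow> real"
  assumes \<omega>: "alternating_form DIM('v) \<omega>"
    and b: "bij_betw b {..<DIM('v)} Basis" and b0: "\<omega> b = 0"
  shows "\<omega> v = 0"
proof -
  let ?d = "DIM('v)"
  have perm: "\<omega> (b \<circ> \<sigma>) = 0" if "\<sigma> permutes {..<?d}" for \<sigma>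
    using finite_lessThan[of "?d"] that
  proof (induction rule: permutes_rev_induct)
    case id
    then show ?case using b0 by simp
  next
    case (swap i j p)
    then show ?case
      using alternating_form_transpose[OF \<omega>, of i j "b \<circ> p"] by (simp add: comp_def)
  qed
  have basis: "\<omega> v = 0" if v: "\<And>i. i < ?d \<Longrightarrow> v i \<in> Basis" for v
  proof (cases "inj_on v {..<?d}")
    case False
    then show ?thesis
      using alternating_form_eq_0[OF \<omega>] by (auto simp: inj_on_def)
  next
    case True
    \<comment> \<open>\<open>\<sigma>\<close> expresses \<open>v\<close> as a rearrangement of
      \<open>b\<close>; it is the identity beyond the relevant slots, as \<open>permutes\<close>
      demands.\<close>
    define \<sigma> where "\<sigma> i = (if i < ?d then inv_into {..<?d} b (v i) else i)" for i
    have bv: "b (\<sigma> i) = v i" "\<sigma> i < ?d" if "i < ?d" for i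
    proof -
      have "v i \<in> b ` {..<?d}" using b v[OF that] by (simp add: bij_betw_def)
      from f_inv_into_f[OF this] inv_into_into[OF this] show "b (\<sigma> i) = v i" "\<sigma> i < ?d"
        using that by (simp_all add: \<sigma>_def)
    qed
    have "inj_on \<sigma> {..<?d}"
      by (rule inj_onI) (metis True bv(1) inj_onD lessThan_iff)
    moreover have "\<sigma> ` {..<?d} \<subseteq> {..<?d}" using bv by auto
    ultimately have "bij_betw \<sigma> {..<?d} {..<?d}"
      by (simp add: bij_betw_def endo_inj_surj)
    then have "\<sigma> permutes {..<?d}"
      by (rule bij_imp_permutes) (simp add: \<sigma>_def)
    moreover have "\<omega> v = \<omega> (b \<circ> \<sigma>)"
      by (rule alternating_form_cong[OF \<omega>]) (simp add: bv)
    ultimately show ?thesis using perm by simp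
  qed
  \<comment> \<open>\<open>m\<close> bounds the leading slots that may hold arbitrary vectors. The
    inductive step expands the last of these in the basis, and taking \<open>m\<close> to be the
    dimension gives the general case.\<close>
  have "\<omega> v = 0" if "m \<le> ?d" "\<And>i. m \<le> i \<Longrightarrow> i < ?d \<Longrightarrow> v i \<in> Basis" for m v
    using that
  proof (induction m arbitrary: v)
    case 0
    then show ?case using basis by simp
  next
    case (Suc m)
    have lin: "linear (\<lambda>u. \<omega> (v(m := u)))"
      using alternating_form_linear[OF \<omega>] Suc.prems by simp
    have "\<omega> v = \<omega> (v(m := \<Sum>e\<in>Basis. (v m \<bullet> e) *\<^sub>R e))"
      by (simp add: euclidean_representation)
    also have "\<dots> = (\<Sum>e\<in>Basis. (v m \<bullet> e) * \<omega> (v(m := e)))"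
      by (simp add: linear_sum[OF lin] linear_scale[OF lin])
    also have "\<dots> = 0"
      using Suc.prems by (intro sum.neutral ballI) (simp add: Suc.IH)
    finally show ?case .
  qed
  from this[of ?d v] show ?thesis by simp
qed

lemma alternating_form_diff:
  assumes \<alpha>: "alternating_form k \<alpha>" and \<beta>: "alternating_form k \<beta>"
  shows "alternating_form k (\<lambda>v. \<alpha> v - \<beta> v)"
  unfolding alternating_form_def
proof (intro conjI allI impI)
  show "\<alpha> v - \<beta> v = \<alpha> w - \<beta> w" if "\<forall>i<k. v i = w i" for v w
    using alternating_form_cong[OF \<alpha>, of v w] alternating_form_cong[OF \<beta>, of v w] that by simp
  show "linear (\<lambda>u. \<alpha> (v(i := u)) - \<beta> (v(i := u)))" if "i < k" for v i
    by (intro linear_compose_sub alternating_form_linear[OF \<alpha> that] alternating_form_linear[OF \<beta> that])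
  show "\<alpha> v - \<beta> v = 0" if "i < k" "j < k" "i \<noteq> j \<and> v i = v j" for v i j
    using alternating_form_eq_0[OF \<alpha> that(1,2)] alternating_form_eq_0[OF \<beta> that(1,2)] that(3) by simp
qed

text \<open>If entries \<open>i\<close> and \<open>j\<close> agree, every summand that leaves both
  alone vanishes. The remaining two have their entries \<open>i\<close> and \<open>j\<close>
  interchanged, hence opposite values.\<close>

lemma alternating_form_derivation:
  fixes A :: "'v::real_vector \<Rightarrow> 'v"
  assumes \<omega>: "alternating_form k \<omega>" and A: "linear A"
  shows "alternating_form k (\<lambda>v. \<Sum>i<k. \<omega> (v(i := A (v i))))"
  unfolding alternating_form_def
proof (intro conjI allI impI)
  fix v w :: "nat \<Rightarrow> 'v" assume "\<forall>i<k. v i = w i"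
  then show "(\<Sum>i<k. \<omega> (v(i := A (v i)))) = (\<Sum>i<k. \<omega> (w(i := A (w i))))"
    by (intro sum.cong refl alternating_form_cong[OF \<omega>]) auto
next
  fix v :: "nat \<Rightarrow> 'v" and j assume j: "j < k"
  have "linear (\<lambda>u. \<omega> ((v(j := u))(i := A ((v(j := u)) i))))" if "i < k" for i
  proof (cases "i = j")
    case True
    then show ?thesis
      using linear_compose[OF A alternating_form_linear[OF \<omega> j, of v]] by (simp add: comp_def)
  next
    case False
    then show ?thesis
      using alternating_form_linear[OF \<omega> j, of "v(i := A (v i))"] by (simp add: fun_upd_twist)
  qed
  then show "linear (\<lambda>u. \<Sum>i<k. \<omega> ((v(j := u))(i := A ((v(j := u)) i))))"
    by (intro linear_compose_sum) auto
next
  fix v :: "nat \<Rightarrow> 'v" and i j assume i: "i < k" and j: "j < k" and "i \<noteq> j \<and> v i = v j"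
  then have ij: "i \<noteq> j" "v i = v j" by auto
  have "(\<Sum>m<k. \<omega> (v(m := A (v m)))) = (\<Sum>m\<in>{i, j}. \<omega> (v(m := A (v m))))"
  proof (rule sum.mono_neutral_right)
    show "\<forall>m\<in>{..<k} - {i, j}. \<omega> (v(m := A (v m))) = 0"
      using alternating_form_eq_0[OF \<omega> i j ij(1)] ij by auto
  qed (use i j in auto)
  moreover have "v(j := A (v j)) = v(i := A (v i)) \<circ> Transposition.transpose i j"
    using ij by (auto simp: fun_eq_iff Transposition.transpose_def)
  ultimately show "(\<Sum>m<k. \<omega> (v(m := A (v m)))) = 0"
    using ij alternating_form_transpose[OF \<omega> i j ij(1), of "v(i := A (v i))"] by simp
qed

text \<open>Both sides are alternating of top degree, so one ordered basis decides. There the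
  component of \<open>A (b i)\<close> along any other basis vector repeats an argument, and only the
  diagonal of \<open>A\<close> survives.\<close>

lemma alternating_top_form_trace:
  fixes A :: "'v::euclidean_space \<Rightarrow> 'v"
  assumes \<omega>: "alternating_form DIM('v) \<omega>" and A: "linear A"
  shows "(\<Sum>i<DIM('v). \<omega> (v(i := A (v i)))) = (\<Sum>e\<in>Basis. A e \<bullet> e) * \<omega> v"
proof -
  obtain b :: "nat \<Rightarrow> 'v" where b: "bij_betw b {..<DIM('v)} Basis"
    using ex_bij_betw_nat_finite[OF finite_Basis] by (auto simp: atLeast0LessThan)
  have "\<omega> (b(i := A (b i))) = (A (b i) \<bullet> b i) * \<omega> b" if i: "i < DIM('v)" for i
  proof -
    have lin: "linear (\<lambda>u. \<omega> (b(i := u)))"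
      using alternating_form_linear[OF \<omega> i] .
    have bi: "b i \<in> Basis" using b i by (auto simp: bij_betw_def)
    have "\<omega> (b(i := e)) = 0" if e: "e \<in> Basis" "e \<noteq> b i" for e
    proof -
      obtain j where "j < DIM('v)" "b j = e"
        using b e(1) by (metis bij_betw_imp_surj_on imageE lessThan_iff)
      with e(2) show ?thesis
        by (intro alternating_form_eq_0[OF \<omega> i, of j]) auto
    qed
    moreover have "\<omega> (b(i := A (b i))) = (\<Sum>e\<in>Basis. (A (b i) \<bullet> e) * \<omega> (b(i := e)))"
      by (subst euclidean_representation[of "A (b i)", symmetric])
        (simp add: linear_sum[OF lin] linear_scale[OF lin] del: euclidean_representation)
    moreover have "(\<Sum>e\<in>Basis. (A (b i) \<bullet> e) * \<omega> (b(i := e))) = (\<Sum>e\<in>{b i}. (A (b i) \<bullet> e) * \<omega> (b(i := e)))"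
      using bi calculation(1) by (intro sum.mono_neutral_right) auto
    ultimately show ?thesis by simp
  qed
  then have "(\<Sum>i<DIM('v). \<omega> (b(i := A (b i)))) = (\<Sum>i<DIM('v). A (b i) \<bullet> b i) * \<omega> b"
    by (simp add: sum_distrib_right)
  also have "(\<Sum>i<DIM('v). A (b i) \<bullet> b i) = (\<Sum>e\<in>Basis. A e \<bullet> e)"
    by (rule sum.reindex_bij_betw[OF b])
  finally have "(\<Sum>i<DIM('v). \<omega> (b(i := A (b i)))) - (\<Sum>e\<in>Basis. A e \<bullet> e) * \<omega> b = 0"
    by (simp only: diff_self)
  note 0 = this
  have "alternating_form DIM('v)
      (\<lambda>v. (\<Sum>i<DIM('v). \<omega> (v(i := A (v i)))) - (\<Sum>e\<in>Basis. A e \<bullet> e) * \<omega> v)"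
    by (intro alternating_form_diff alternating_form_derivation alternating_form_cmult \<omega> A)
  from alternating_top_form_eq_0[OF this b 0, of v] show ?thesis
    by (rule eq_iff_diff_eq_0[THEN iffD2])
qed

lemma lie_derivative_density:
  fixes X :: "'v::euclidean_space \<Rightarrow> 'v"
  assumes \<omega>: "alternating_form DIM('v) \<omega>"
    and f: "(f has_derivative f') (at y)" and X: "(X has_derivative X') (at y)"
  shows "lie_derivative DIM('v) X (\<lambda>y v. f y * \<omega> v) y v =
    (f' (X y) + f y * (\<Sum>e\<in>Basis. X' e \<bullet> e)) * \<omega> v"
proof -
  have X': "linear X'" using X by (rule has_derivative_linear)
  \<comment> \<open>A constant field has derivative zero, so the bracket retains only the term with
    \<open>X'\<close>. Its minus sign turns the subtracted sum of the Lie derivative into an added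
    trace.\<close>
  have "lie_bracket X (\<lambda>_. u) y = - X' u" for u
    by (simp add: lie_bracket_def frechet_derivative_at[OF X, symmetric])
  moreover have "\<omega> (v(i := - X' (v i))) = - \<omega> (v(i := X' (v i)))" if "i < DIM('v)" for i
    using linear_neg[OF alternating_form_linear[OF \<omega> that]] .
  moreover have "((\<lambda>u. f u * \<omega> v) has_derivative (\<lambda>u. f' u * \<omega> v)) (at y)"
    by (intro has_derivative_mult_left f)
  then have "frechet_derivative (\<lambda>u. f u * \<omega> v) (at y) = (\<lambda>u. f' u * \<omega> v)"
    by (rule frechet_derivative_at[symmetric])
  ultimately have "lie_derivative DIM('v) X (\<lambda>y v. f y * \<omega> v) y v =
      f' (X y) * \<omega> v + f y * (\<Sum>i<DIM('v). \<omega> (v(i := X' (v i))))"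
    unfolding lie_derivative_def by (simp add: sum_negf sum_distrib_left)
  then show ?thesis
    unfolding alternating_top_form_trace[OF \<omega> X'] by (simp add: algebra_simps)
qed

section \<open>Smooth functions\<close>

lemma C_diff_on_Suc_imp: "C_diff_on (Suc k) S f \<Longrightarrow> C_diff_on k S f"
proof (induction k arbitrary: f)
  case 0
  then show ?case
    by (auto intro!: continuous_at_imp_continuous_on differentiable_imp_continuous_within)
next
  case (Suc k)
  show ?case
    unfolding C_diff_on.simps(2)[of k] using Suc.prems Suc.IH by (subst (asm) C_diff_on.simps(2)) auto
qed

text \<open>A derivative depends on nearby values, so agreement on \<open>S\<close> passes to the
  derivatives because \<open>S\<close> is open.\<close>

lemma C_diff_on_cong:
  assumes "open S" "\<And>x. x \<in> S \<Longrightarrow> f x = g x" "C_diff_on k S f"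
  shows "C_diff_on k S g"
  using assms(2,3)
proof (induction k arbitrary: f g)
  case 0
  then show ?case by (simp cong: continuous_on_cong)
next
  case (Suc k)
  have d: "(g has_derivative frechet_derivative f (at x)) (at x)" if "x \<in> S" for x
    using Suc.prems that assms(1)
    by (intro has_derivative_transform_within_open[of f _ x UNIV S g]) (auto simp: frechet_derivative_works[symmetric])
  show ?case
    unfolding C_diff_on.simps
  proof (intro conjI ballI allI)
    show "g differentiable at x" if "x \<in> S" for x
      by (rule differentiableI[OF d[OF that]])
    show "C_diff_on k S (\<lambda>x. frechet_derivative g (at x) v)" for v
    proof (rule Suc.IH)
      show "frechet_derivative f (at x) v = frechet_derivative g (at x) v" if "x \<in> S" for x
        by (rule fun_cong[OF frechet_derivative_at[OF d[OF that]]])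
      show "C_diff_on k S (\<lambda>x. frechet_derivative f (at x) v)"
        using Suc.prems(2) by simp
    qed
  qed
qed

text \<open>By uniqueness of the derivative, an explicit \<open>f'\<close> can replace the
  \<open>frechet_derivative\<close> of the definition; the inductions below can then use the
  standard differentiation rules.\<close>

lemma C_diff_on_SucI:
  assumes "open S" "\<And>x. x \<in> S \<Longrightarrow> (f has_derivative f' x) (at x)"
    "\<And>v. C_diff_on k S (\<lambda>x. f' x v)"
  shows "C_diff_on (Suc k) S f"
  unfolding C_diff_on.simps
proof (intro conjI ballI allI)
  show "f differentiable at x" if "x \<in> S" for x
    by (rule differentiableI[OF assms(2)[OF that]])
  show "C_diff_on k S (\<lambda>x. frechet_derivative f (at x) v)" for v
    by (rule C_diff_on_cong[OF assms(1) _ assms(3)])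
      (rule fun_cong[OF frechet_derivative_at[OF assms(2)]])
qed

lemma C_diff_on_const: "open S \<Longrightarrow> C_diff_on k S (\<lambda>x. c)"
proof (induction k arbitrary: c)
  case (Suc k)
  show ?case by (rule C_diff_on_SucI[OF Suc.prems has_derivative_const Suc.IH[OF Suc.prems]])
qed simp

lemma C_diff_on_bounded_linear:
  assumes "open S" "bounded_linear f" shows "C_diff_on k S f"
proof (cases k)
  case 0
  then show ?thesis
    by (simp add: linear_continuous_on assms)
next
  case (Suc m)
  show ?thesis unfolding Suc
    by (rule C_diff_on_SucI[OF assms(1) bounded_linear_imp_has_derivative[OF assms(2)]
          C_diff_on_const[OF assms(1)]])
qed

lemma has_derivative_frechet_derivative:
  "C_diff_on (Suc k) S f \<Longrightarrow> x \<in> S \<Longrightarrow> (f has_derivative frechet_derivative f (at x)) (at x)"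
  by (simp add: frechet_derivative_works[symmetric])

lemma C_diff_on_add:
  assumes "open S" "C_diff_on k S f" "C_diff_on k S g"
  shows "C_diff_on k S (\<lambda>x. f x + g x)"
  using assms(2,3)
proof (induction k arbitrary: f g)
  case (Suc k)
  show ?case
    by (rule C_diff_on_SucI[OF assms(1) has_derivative_add[OF
          has_derivative_frechet_derivative[OF Suc.prems(1)] has_derivative_frechet_derivative[OF Suc.prems(2)]]])
      (use Suc in auto)
qed (auto intro: continuous_on_add continuous_on_mult)

lemma C_diff_on_mult:
  fixes f g :: "'a::real_normed_vector \<Rightarrow> real"
  assumes "open S" "C_diff_on k S f" "C_diff_on k S g"
  shows "C_diff_on k S (\<lambda>x. f x * g x)"
  using assms(2,3)
proof (induction k arbitrary: f g)
  case (Suc k)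
  show ?case
    by (rule C_diff_on_SucI[OF assms(1) has_derivative_mult[OF
          has_derivative_frechet_derivative[OF Suc.prems(1)] has_derivative_frechet_derivative[OF Suc.prems(2)]]])
      (use Suc C_diff_on_Suc_imp[OF Suc.prems(1)] C_diff_on_Suc_imp[OF Suc.prems(2)]
        in \<open>auto intro!: C_diff_on_add[OF assms(1)]\<close>)
qed (auto intro: continuous_on_mult)

lemma C_diff_on_inverse:
  fixes f :: "'a::real_normed_vector \<Rightarrow> real"
  assumes "open S" "C_diff_on k S f" "\<And>x. x \<in> S \<Longrightarrow> f x \<noteq> 0"
  shows "C_diff_on k S (\<lambda>x. inverse (f x))"
  using assms(2)
proof (induction k)
  case (Suc k)
  have i: "C_diff_on k S (\<lambda>x. inverse (f x))"
    using Suc C_diff_on_Suc_imp by blast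
  \<comment> \<open>The derivative of 1/f is built from 1/f and the derivative of f alone, so the
    induction closes.\<close>
  have "C_diff_on k S (\<lambda>x. (- 1) * (inverse (f x) * frechet_derivative f (at x) v * inverse (f x)))" for v
    using Suc.prems i by (intro C_diff_on_mult C_diff_on_const assms(1)) auto
  then show ?case
    by (intro C_diff_on_SucI[OF assms(1) Deriv.has_derivative_inverse[OF assms(3)
          has_derivative_frechet_derivative[OF Suc.prems]]]) auto
qed (use assms(3) in \<open>auto intro: continuous_on_inverse\<close>)

text \<open>A linear inner map has constant derivative, so each directional derivative is again a
  function composed with \<open>\<pi>\<close>, and no chain rule of higher order is required. The
  case of interest is the projection to the momenta.\<close>

lemma C_diff_on_compose_linear:
  assumes "open S" "bounded_linear \<pi>" "\<pi> ` S \<subseteq> T" "C_diff_on k T g"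
  shows "C_diff_on k S (\<lambda>x. g (\<pi> x))"
  using assms(4)
proof (induction k arbitrary: g)
  case 0
  then have "continuous_on (\<pi> ` S) g"
    using assms(3) continuous_on_subset by auto
  from continuous_on_compose[OF linear_continuous_on[OF assms(2)] this] show ?case
    by (simp add: comp_def)
next
  case (Suc k)
  show ?case
    by (rule C_diff_on_SucI[OF assms(1) has_derivative_compose[OF
          bounded_linear_imp_has_derivative[OF assms(2)]
          has_derivative_frechet_derivative[OF Suc.prems]]])
      (use assms(3) Suc.prems Suc.IH[of "\<lambda>x. frechet_derivative g (at x) (\<pi> _)"] in auto)
qed

section \<open>Closure properties of smooth functions\<close>

lemma smooth_on_cong:
  "open S \<Longrightarrow> (\<And>x. x \<in> S \<Longrightarrow> f x = g x) \<Longrightarrow> smooth_on S f \<Longrightarrow> smooth_on S g"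
  unfolding smooth_on_def by (blast intro: C_diff_on_cong)

lemma smooth_on_const: "open S \<Longrightarrow> smooth_on S (\<lambda>x. c)"
  by (simp add: smooth_on_def C_diff_on_const)

lemma smooth_on_bounded_linear: "open S \<Longrightarrow> bounded_linear f \<Longrightarrow> smooth_on S f"
  by (simp add: smooth_on_def C_diff_on_bounded_linear)

lemma smooth_on_add:
  "open S \<Longrightarrow> smooth_on S f \<Longrightarrow> smooth_on S g \<Longrightarrow> smooth_on S (\<lambda>x. f x + g x)"
  by (simp add: smooth_on_def C_diff_on_add)

lemma smooth_on_mult:
  fixes f g :: "'a::real_normed_vector \<Rightarrow> real"
  shows "open S \<Longrightarrow> smooth_on S f \<Longrightarrow> smooth_on S g \<Longrightarrow> smooth_on S (\<lambda>x. f x * g x)"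
  by (simp add: smooth_on_def C_diff_on_mult)

lemma smooth_on_diff:
  fixes f g :: "'a::real_normed_vector \<Rightarrow> real"
  assumes "open S" "smooth_on S f" "smooth_on S g"
  shows "smooth_on S (\<lambda>x. f x - g x)"
  using smooth_on_add[OF assms(1,2) smooth_on_mult[OF assms(1) smooth_on_const[OF assms(1), of "- 1"] assms(3)]]
  by simp

lemma smooth_on_sum:
  "open S \<Longrightarrow> (\<And>i. i \<in> I \<Longrightarrow> smooth_on S (f i)) \<Longrightarrow> smooth_on S (\<lambda>x. \<Sum>i\<in>I. f i x)"
  by (induction I rule: infinite_finite_induct) (auto intro: smooth_on_add smooth_on_const)

lemma smooth_on_power:
  fixes f :: "'a::real_normed_vector \<Rightarrow> real"
  shows "open S \<Longrightarrow> smooth_on S f \<Longrightarrow> smooth_on S (\<lambda>x. f x ^ m)"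
  by (induction m) (auto intro: smooth_on_mult smooth_on_const)

lemma smooth_on_inverse:
  fixes f :: "'a::real_normed_vector \<Rightarrow> real"
  shows "open S \<Longrightarrow> smooth_on S f \<Longrightarrow> (\<And>x. x \<in> S \<Longrightarrow> f x \<noteq> 0) \<Longrightarrow> smooth_on S (\<lambda>x. inverse (f x))"
  by (simp add: smooth_on_def C_diff_on_inverse)

lemma smooth_on_compose_linear:
  "open S \<Longrightarrow> bounded_linear \<pi> \<Longrightarrow> \<pi> ` S \<subseteq> T \<Longrightarrow> smooth_on T g \<Longrightarrow> smooth_on S (\<lambda>x. g (\<pi> x))"
  by (simp add: smooth_on_def C_diff_on_compose_linear)

lemma smooth_on_frechet_derivative:
  "smooth_on S f \<Longrightarrow> smooth_on S (\<lambda>x. frechet_derivative f (at x) v)"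
  unfolding smooth_on_def using C_diff_on.simps(2) by blast

lemma smooth_on_has_derivative:
  "smooth_on S f \<Longrightarrow> x \<in> S \<Longrightarrow> (f has_derivative frechet_derivative f (at x)) (at x)"
  using has_derivative_frechet_derivative[of 0] unfolding smooth_on_def by blast

lemma smooth_on_imp_continuous_on: "smooth_on S f \<Longrightarrow> continuous_on S f"
  using C_diff_on.simps(1) unfolding smooth_on_def by blast

lemma smooth_on_subset:
  assumes "smooth_on T f" "S \<subseteq> T"
  shows "smooth_on S f"
proof -
  have "C_diff_on k S f" if "C_diff_on k T f" for k
    using that
  proof (induction k arbitrary: f)
    case 0
    then show ?case using assms(2) by (auto intro: continuous_on_subset)
  next
    case (Suc k)
    then show ?case using assms(2) by auto
  qed
  then show ?thesis using assms(1) by (simp add: smooth_on_def)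
qed

lemma smooth_on_powi:
  fixes f :: "'a::real_normed_vector \<Rightarrow> real"
  assumes "open S" "smooth_on S f" "\<And>x. x \<in> S \<Longrightarrow> f x \<noteq> 0"
  shows "smooth_on S (\<lambda>x. f x powi m)"
proof (cases "0 \<le> m")
  case True
  then show ?thesis by (simp add: power_int_def smooth_on_power assms(1,2))
next
  case False
  then show ?thesis by (simp add: power_int_def smooth_on_power smooth_on_inverse assms)
qed

section \<open>The contact volume form\<close>

lemma alternating_contact_form: "alternating_form 1 (contact_form y)"
proof -
  have "linear (\<lambda>u :: 'n::finite contact_space. snd (snd u) - (\<Sum>a\<in>UNIV. p $ a * fst u $ a))" for p
    by (simp add: linear_iff sum.distrib sum_distrib_left ring_distribs mult_ac)
  then show ?thesis
    unfolding alternating_form_def by (cases y) (simp add: contact_form_def case_prod_beta)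
qed

lemma alternating_ext_deriv_contact_form:
  "alternating_form 2 (ext_deriv 1 contact_form (y :: 'n::finite contact_space))"
  unfolding alternating_form_def
proof (intro conjI allI impI)
  fix v :: "nat \<Rightarrow> 'n contact_space" and i :: nat assume "i < 2"
  then have "i = 0 \<or> i = 1" by auto
  then show "linear (\<lambda>u. ext_deriv 1 contact_form y (v(i := u)))"
    by (auto simp only: ext_deriv_contact_form)
      (auto simp: linear_iff algebra_simps sum.distrib sum_distrib_left sum_subtractf)
next
  fix v :: "nat \<Rightarrow> 'n contact_space" and i j :: nat
  assume "i < 2" "j < 2" and "i \<noteq> j \<and> v i = v j"
  then have "v 0 = v 1" by (cases "i = 0"; cases "j = 0") (auto simp: less_2_cases_iff)
  then show "ext_deriv 1 contact_form y v = 0"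
    unfolding ext_deriv_contact_form by (simp add: mult.commute)
next
  fix v w :: "nat \<Rightarrow> 'n contact_space" assume "\<forall>i<2. v i = w i"
  then have "v 0 = w 0" "v 1 = w 1" by auto
  then show "ext_deriv 1 contact_form y v = ext_deriv 1 contact_form y w"
    by (simp only: ext_deriv_contact_form)
qed

lemma alternating_contact_volume:
  "alternating_form DIM('n contact_space) (contact_volume (y :: 'n::finite contact_space))"
proof -
  have "alternating_form (1 + CARD('n) * 2) (contact_volume y)"
    unfolding contact_volume_def
    by (intro alternating_form_wedge alternating_contact_form alternating_form_wedge_power
        alternating_ext_deriv_contact_form)
  moreover have "DIM('n contact_space) = 1 + CARD('n) * 2" by simp
  ultimately show ?thesis by (simp only:)
qed

text \<open>In this single sum, slot 0 feeds \<lambda>, and slots 2i + 1 and 2i + 2 feed the i-th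
  copy of d\<lambda>.\<close>

lemma contact_volume_eq_alternate:
  fixes y :: "'n::finite contact_space"
  shows "contact_volume y v = (1 / 2) ^ CARD('n) * alternate (1 + CARD('n) * 2)
    (\<lambda>v. contact_form y v *
      (\<Prod>i<CARD('n). ext_deriv 1 contact_form y (\<lambda>j. v (1 + (2 * i + j))))) v"
proof -
  have "wedge_power 2 (ext_deriv 1 contact_form) CARD('n) y v = (1 / 2) ^ CARD('n) *
      alternate (CARD('n) * 2) (\<lambda>v. \<Prod>i<CARD('n). ext_deriv 1 contact_form y (\<lambda>j. v (2 * i + j))) v" for v
    by (rule wedge_power_2_eq_alternate)
      (rule alternating_form_cong[OF alternating_ext_deriv_contact_form])
  then have "contact_volume y v = (1 / 2) ^ CARD('n) / fact 1 * alternate (1 + CARD('n) * 2)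
      (\<lambda>v. contact_form y v *
        (\<Prod>i<CARD('n). ext_deriv 1 contact_form y (\<lambda>j. (\<lambda>i. v (1 + i)) (2 * i + j)))) v"
    unfolding contact_volume_def
    by (intro wedge_alternate) (rule alternating_form_cong[OF alternating_contact_form])
  then show ?thesis by (simp only: fact_1 div_by_1)
qed

text \<open>The part $p_a\,dx^a$ of $\lambda$ does not contribute to $\lambda\wedge(d\lambda)^n$: in a
  nonzero term of the expansion on the standard basis, $\partial/\partial z$ has to be inserted into
  $\lambda$, as it annihilates $d\lambda$.\<close>
lemma contact_volume_eq_at_0:
  fixes y :: "'n::finite contact_space"
  shows "contact_volume y v = contact_volume 0 v"
proof -
  let ?d = "DIM('n contact_space)"
  have d: "?d = 1 + CARD('n) * 2" by simp
  obtain b :: "nat \<Rightarrow> 'n contact_space" where b: "bij_betw b {..<?d} Basis"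
    using ex_bij_betw_nat_finite[OF finite_Basis[where 'a = "'n contact_space"]]
    by (auto simp only: lessThan_atLeast0)
  have "(0, 0, 1) \<in> (Basis :: 'n contact_space set)"
    by (simp add: Basis_prod_def)
  then have "(0, 0, 1) \<in> b ` {..<1 + CARD('n) * 2}"
    using bij_betw_imp_surj_on[OF b] by (simp only: d)
  then obtain j where j: "j < 1 + CARD('n) * 2" "b j = (0, 0, 1)"
    unfolding image_iff by (metis lessThan_iff)
  have "contact_volume y b = contact_volume 0 b"
    unfolding contact_volume_eq_alternate alternate_def
  proof (rule arg_cong2[where f = "(*)", OF refl], rule sum.cong[OF refl],
      rule arg_cong2[where f = "(*)", OF refl])
    fix \<sigma> assume "\<sigma> \<in> {\<sigma>. \<sigma> permutes {..<1 + CARD('n) * 2}}"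
    then have \<sigma>: "\<sigma> permutes {..<1 + CARD('n) * 2}" by simp
    \<comment> \<open>\<open>k\<close> is the slot into which \<sigma> puts the vector
      \<partial>/\<partial>z.\<close>
    define k where "k = inv \<sigma> j"
    have k: "k < 1 + CARD('n) * 2" "\<sigma> k = j"
      using permutes_in_image[OF permutes_inv[OF \<sigma>], of j] permutes_inverses[OF \<sigma>] j(1)
      by (auto simp: k_def)
    let ?B = "\<lambda>y. \<Prod>i<CARD('n). ext_deriv 1 contact_form y (\<lambda>j. b (\<sigma> (1 + (2 * i + j))))"
    show "contact_form y (\<lambda>i. b (\<sigma> i)) * ?B y = contact_form 0 (\<lambda>i. b (\<sigma> i)) * ?B 0"
    proof (cases "k = 0")
      case True
      with k j have "b (\<sigma> 0) = (0, 0, 1)" by simp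
      then have "contact_form y (\<lambda>i. b (\<sigma> i)) = contact_form 0 (\<lambda>i. b (\<sigma> i))"
        by (simp add: contact_form_def case_prod_beta)
      then show ?thesis by (simp only: ext_deriv_contact_form)
    next
      case False
      \<comment> \<open>The number of the copy of d\<lambda> that receives slot \<open>k\<close>;
        that factor is zero at every point.\<close>
      define i where "i = (k - 1) div 2"
      have i: "i < CARD('n)" "k = 1 + (2 * i + 0) \<or> k = 1 + (2 * i + 1)"
        using False k(1) by (auto simp: i_def)
      have "ext_deriv 1 contact_form y (\<lambda>j. b (\<sigma> (1 + (2 * i + j)))) = 0" for y
        using i(2) k(2) j(2) by (auto simp only: ext_deriv_contact_form) simp_all
      then have "?B y = 0" for y
        using i(1) by (intro prod_zero bexI[of _ i]) (simp_all only: finite_lessThan lessThan_iff)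
      then show ?thesis by (simp only: mult_zero_right)
    qed
  qed
  then have 0: "contact_volume y b - contact_volume 0 b = 0"
    by (rule eq_iff_diff_eq_0[THEN iffD1])
  have "alternating_form ?d (\<lambda>v. contact_volume y v - contact_volume 0 v)"
    by (intro alternating_form_diff alternating_contact_volume)
  from alternating_top_form_eq_0[OF this b 0, of v] show ?thesis
    by (rule eq_iff_diff_eq_0[THEN iffD2])
qed

section \<open>Non-vanishing of the contact volume\<close>

text \<open>The matrix of d\<lambda> in the frame that lists \<partial>/\<partial>x and
  \<partial>/\<partial>p in conjugate pairs: odd indices are x-directions, and each is followed by
  its momentum direction. Index 0 is left for \<partial>/\<partial>z.\<close>

definition pair_sign :: "nat \<Rightarrow> nat \<Rightarrow> real" where
  "pair_sign i j = (if odd i \<and> j = Suc i then 1 else if odd j \<and> i = Suc j then - 1 else 0)"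

text \<open>A permutation mapping each of the pairs \<open>{2i + 1, 2i + 2}\<close> onto such a pair has sign
  $(-1)^f$, where \<open>f\<close> is the number of pairs that it flips.\<close>
lemma sign_mult_prod_pair_sign_nonneg:
  assumes "\<sigma> permutes {1..2 * m}"
  shows "0 \<le> of_int (sign \<sigma>) * (\<Prod>i<m. pair_sign (\<sigma> (2 * i + 1)) (\<sigma> (2 * i + 2)))"
  using assms
proof (induction m arbitrary: \<sigma>)
  case 0
  then show ?case by simp
next
  case (Suc m)
  let ?a = "2 * m + 1" and ?b = "2 * m + 2"
  have S: "{1..2 * Suc m} = {1..?b}" by simp
  \<comment> \<open>The case where \<sigma> keeps the order within the last pair; the flipped case
    is reduced to it below.\<close>
  have good: "0 \<le> of_int (sign \<sigma>) * (\<Prod>i<m. pair_sign (\<sigma> (2 * i + 1)) (\<sigma> (2 * i + 2)))"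
    if \<sigma>: "\<sigma> permutes {1..?b}" and p: "odd (\<sigma> ?a)" "\<sigma> ?b = Suc (\<sigma> ?a)" for \<sigma>
  proof -
    define p where "p = \<sigma> ?a"
    \<comment> \<open>\<open>\<tau>\<close> exchanges the image of the last pair with the last pair
      itself. It is even, being made of two transpositions (or trivial), and preserves
      \<open>pair_sign\<close>; after composing with it the last pair is fixed and the induction
      hypothesis applies.\<close>
    define \<tau> where "\<tau> = Transposition.transpose p ?a \<circ> Transposition.transpose (Suc p) ?b"
    have "?a \<in> {1..?b}" "?b \<in> {1..?b}" by auto
    then have "p \<in> {1..?b}" "Suc p \<in> {1..?b}"
      using permutes_in_image[OF \<sigma>] p(2) unfolding p_def by metis+
    then have t1: "Transposition.transpose p ?a permutes {1..?b}"
      and t2: "Transposition.transpose (Suc p) ?b permutes {1..?b}"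
      by (auto intro: permutes_swap_id)
    have \<tau>: "\<tau> permutes {1..?b}"
      unfolding \<tau>_def by (rule permutes_compose[OF t2 t1])
    have odd: "odd p" using p by (simp add: p_def)
    have "sign \<tau> = 1"
      unfolding \<tau>_def using odd by (subst sign_compose) (auto simp: sign_swap_id permutation_swap_id)
    moreover have "sign (\<tau> \<circ> \<sigma>) = sign \<tau> * sign \<sigma>"
      using \<tau> \<sigma> by (intro sign_compose) (auto intro: permutes_imp_permutation[of "{1..?b}"])
    ultimately have sgn: "sign (\<tau> \<circ> \<sigma>) = sign \<sigma>" by simp
    have parity: "odd (\<tau> i) \<longleftrightarrow> odd i" for i
      using odd by (auto simp: \<tau>_def Transposition.transpose_def)
    have "\<tau> (Suc i) = Suc (\<tau> i)" if "odd i" for i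
      using odd that by (auto simp: \<tau>_def Transposition.transpose_def)
    then have "\<tau> j = Suc (\<tau> i) \<longleftrightarrow> j = Suc i" if "odd i" for i j
      using that inj_eq[OF permutes_inj[OF \<tau>], of j "Suc i"] by simp
    then have pair: "pair_sign (\<tau> i) (\<tau> j) = pair_sign i j" for i j
      unfolding pair_sign_def by (simp add: parity cong: conj_cong)
    have "(\<tau> \<circ> \<sigma>) permutes {1..2 * m}"
    proof (rule permutes_superset[OF permutes_compose[OF \<sigma> \<tau>]])
      fix x assume "x \<in> {1..?b} - {1..2 * m}"
      then have "x = ?a \<or> x = ?b" by auto
      moreover have "\<tau> p = ?a" "\<tau> (Suc p) = ?b"
        using odd by (auto simp: \<tau>_def Transposition.transpose_def)
      ultimately show "(\<tau> \<circ> \<sigma>) x = x"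
        using p(2) by (auto simp: p_def)
    qed
    from Suc.IH[OF this] show ?thesis
      unfolding sgn by (simp add: pair)
  qed
  have \<sigma>: "\<sigma> permutes {1..?b}" using Suc.prems S by simp
  consider "odd (\<sigma> ?a) \<and> \<sigma> ?b = Suc (\<sigma> ?a)" | "odd (\<sigma> ?b) \<and> \<sigma> ?a = Suc (\<sigma> ?b)"
    | "pair_sign (\<sigma> ?a) (\<sigma> ?b) = 0"
    unfolding pair_sign_def by argo
  then show ?case
  proof cases
    case 1
    then have "pair_sign (\<sigma> ?a) (\<sigma> ?b) = 1"
      by (simp add: pair_sign_def)
    with good[OF \<sigma>] 1 show ?thesis by simp
  next
    case 2
    \<comment> \<open>Undoing the flip changes both the sign of \<sigma> and the last factor of the
      product, so the value to be estimated is unchanged.\<close>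
    let ?t = "Transposition.transpose ?a ?b"
    have t: "?t permutes {1..?b}"
      by (rule permutes_swap_id) auto
    have "sign (\<sigma> \<circ> ?t) = sign \<sigma> * sign ?t"
      using \<sigma> t by (intro sign_compose) (auto intro: permutes_imp_permutation[of "{1..?b}"])
    then have sgn: "sign (\<sigma> \<circ> ?t) = - sign \<sigma>"
      by (simp add: sign_swap_id)
    have "(\<Prod>i<m. pair_sign ((\<sigma> \<circ> ?t) (2 * i + 1)) ((\<sigma> \<circ> ?t) (2 * i + 2))) =
        (\<Prod>i<m. pair_sign (\<sigma> (2 * i + 1)) (\<sigma> (2 * i + 2)))"
      by (intro prod.cong refl) (auto simp: Transposition.transpose_def)
    moreover have "0 \<le> of_int (sign (\<sigma> \<circ> ?t)) *
        (\<Prod>i<m. pair_sign ((\<sigma> \<circ> ?t) (2 * i + 1)) ((\<sigma> \<circ> ?t) (2 * i + 2)))"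
      by (rule good[OF permutes_compose[OF t \<sigma>]]) (use 2 in auto)
    moreover have "pair_sign (\<sigma> ?a) (\<sigma> ?b) = - 1"
      using 2 by (auto simp: pair_sign_def)
    ultimately show ?thesis unfolding sgn by simp
  next
    case 3
    then show ?thesis by simp
  qed
qed

text \<open>On a frame of conjugate pairs preceded by \<partial>/\<partial>z, no term of the
  permutation sum is negative and the identity contributes a positive one, so nothing cancels. The
  origin suffices since the form is the same at all points.\<close>

lemma contact_volume_nonzero:
  fixes y :: "'n::finite contact_space"
  shows "\<exists>v. contact_volume y v \<noteq> 0"
proof -
  let ?n = "CARD('n)"
  obtain e :: "nat \<Rightarrow> 'n" where "bij_betw e {..<?n} UNIV"
    using ex_bij_betw_nat_finite[of "UNIV :: 'n set"] by (auto simp: lessThan_atLeast0)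
  then have e: "e i = e j \<longleftrightarrow> i = j" if "i < ?n" "j < ?n" for i j
    using that by (auto simp: bij_betw_def inj_on_def)
  \<comment> \<open>Pair number i, counted from 0, sits at indices 2i + 1 and 2i + 2; hence the
    \<open>- 1\<close> for even indices.\<close>
  define v :: "nat \<Rightarrow> 'n contact_space" where
    "v i = (if i = 0 then (0, 0, 1) else if odd i then (axis (e (i div 2)) 1, 0, 0)
      else (0, axis (e (i div 2 - 1)) 1, 0))" for i
  have ax: "(\<Sum>a\<in>UNIV. axis i (1::real) $ a * axis j 1 $ a) = (if i = j then 1 else 0)" for i j :: 'n
    using inner_axis_axis[of i "1::real" j 1] by (simp add: inner_vec_def)
  have pair: "ext_deriv 1 contact_form y w = pair_sign i j"
    if "i \<in> {1..2 * ?n}" "j \<in> {1..2 * ?n}" "w 0 = v i" "w 1 = v j" for i j w and y :: "'n contact_space"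
  proof (cases "odd i"; cases "odd j")
    assume ij: "odd i" "\<not> odd j"
    then have "i div 2 = j div 2 - 1 \<longleftrightarrow> j = Suc i" using that by (auto elim!: oddE evenE)
    moreover have "i div 2 < ?n" "j div 2 - 1 < ?n" using that ij by (auto elim!: oddE evenE)
    ultimately show ?thesis
      unfolding ext_deriv_contact_form that
      using that ij by (auto simp: v_def pair_sign_def ax e)
  next
    assume ij: "\<not> odd i" "odd j"
    then have "j div 2 = i div 2 - 1 \<longleftrightarrow> i = Suc j" using that by (auto elim!: oddE evenE)
    moreover have "j div 2 < ?n" "i div 2 - 1 < ?n" using that ij by (auto elim!: oddE evenE)
    ultimately show ?thesis
      unfolding ext_deriv_contact_form that
      using that ij by (auto simp: v_def pair_sign_def ax e sum_negf)
  qed (use that in \<open>auto simp: ext_deriv_contact_form[simplified] v_def pair_sign_def\<close>)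
  let ?B = "\<lambda>\<sigma>. \<Prod>i<?n. ext_deriv 1 contact_form 0 (\<lambda>j. v (\<sigma> (1 + (2 * i + j))))"
  let ?f = "\<lambda>\<sigma>. of_int (sign \<sigma>) * (contact_form 0 (\<lambda>i. v (\<sigma> i)) * ?B \<sigma>)"
  \<comment> \<open>At the origin \<lambda> is dz, so only permutations fixing 0 contribute, and
    these permute the paired indices among themselves.\<close>
  have 1: "contact_form 0 (\<lambda>i. v (\<sigma> i)) = (if \<sigma> 0 = 0 then 1 else 0)" for \<sigma>
    by (auto simp: contact_form_def v_def zero_prod_def)
  have B: "?B \<sigma> = (\<Prod>i<?n. pair_sign (\<sigma> (2 * i + 1)) (\<sigma> (2 * i + 2)))"
    if \<sigma>: "\<sigma> permutes {1..2 * ?n}" for \<sigma>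
  proof (intro prod.cong refl)
    fix i assume "i \<in> {..<?n}"
    then have "2 * i + 1 \<in> {1..2 * ?n}" "2 * i + 2 \<in> {1..2 * ?n}" by auto
    then show "ext_deriv 1 contact_form 0 (\<lambda>j. v (\<sigma> (1 + (2 * i + j)))) =
        pair_sign (\<sigma> (2 * i + 1)) (\<sigma> (2 * i + 2))"
      by (intro pair) (simp_all only: permutes_in_image[OF \<sigma>], simp_all add: add.commute)
  qed
  have "0 < sum ?f {\<sigma>. \<sigma> permutes {..<1 + ?n * 2}}"
  proof (rule sum_pos2)
    show "finite {\<sigma>. \<sigma> permutes {..<1 + ?n * 2}}"
      by (rule finite_permutations) simp
    show "id \<in> {\<sigma>. \<sigma> permutes {..<1 + ?n * 2}}"
      by (simp add: permutes_id)
    show "0 < ?f id"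
      unfolding 1 B[OF permutes_id] by (simp add: pair_sign_def)
    fix \<sigma> assume "\<sigma> \<in> {\<sigma>. \<sigma> permutes {..<1 + ?n * 2}}"
    then have \<sigma>: "\<sigma> permutes {..<1 + ?n * 2}" by simp
    show "0 \<le> ?f \<sigma>"
    proof (cases "\<sigma> 0 = 0")
      case True
      have "\<sigma> permutes {1..2 * ?n}"
      proof (rule permutes_superset[OF \<sigma>])
        fix x assume "x \<in> {..<1 + ?n * 2} - {1..2 * ?n}"
        then have "x = 0" by auto
        with True show "\<sigma> x = x" by simp
      qed
      note this' = this
      from sign_mult_prod_pair_sign_nonneg[OF this] show ?thesis
        unfolding 1 B[OF this'] using True by simp
    qed (simp add: 1)
  qed
  then have "contact_volume 0 v \<noteq> 0"
    unfolding contact_volume_eq_alternate alternate_def by simp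
  then show ?thesis
    using contact_volume_eq_at_0[of y] by auto
qed

section \<open>Contact Hamiltonians affine in \<open>x\<close> and \<open>z\<close>\<close>

lemma contact_hamiltonian_field_derivative:
  assumes "contact_hamiltonian_field S h X" "y \<in> S"
  shows "frechet_derivative h (at y) (X y) = reeb_deriv h y * h y"
proof -
  let ?v = "\<lambda>_. X y"
  have "contact_form y ?v = h y"
    using assms unfolding contact_hamiltonian_field_def interior_product_def contact_form_def
    by (fastforce simp: case_prod_beta)
  moreover have "interior_product X (ext_deriv 1 contact_form) y ?v = 0"
    unfolding interior_product_def ext_deriv_contact_form by (simp add: mult.commute)
  moreover have "ext_deriv 0 (zero_form h) y ?v = frechet_derivative h (at y) (X y)"
    by (simp add: ext_deriv_def zero_form_def)
  ultimately show ?thesis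
    using assms unfolding contact_hamiltonian_field_def by fastforce
qed

lemma has_derivative_vec_lambda:
  fixes f :: "'n::finite \<Rightarrow> 'a::real_normed_vector \<Rightarrow> real"
  assumes "\<And>a. (f a has_derivative f' a) F"
  shows "((\<lambda>y. \<chi> a. f a y) has_derivative (\<lambda>u. \<chi> a. f' a u)) F"
proof -
  have eq: "(\<chi> a. c a) = (\<Sum>a\<in>UNIV. c a *\<^sub>R axis a (1::real))" for c :: "'n \<Rightarrow> real"
    using basis_expansion[of "\<chi> a. c a"] by (simp add: scalar_mult_eq_scaleR)
  show ?thesis
    unfolding eq by (intro has_derivative_sum has_derivative_scaleR_left assms)
qed

text \<open>Together with \<open>sum_Basis_vec\<close>, this splits the trace into its x-, p- and
  z-blocks.\<close>

lemma sum_Basis_prod: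
  fixes g :: "'a::euclidean_space \<times> 'b::euclidean_space \<Rightarrow> 'c::comm_monoid_add"
  shows "sum g Basis = (\<Sum>u\<in>Basis. g (u, 0)) + (\<Sum>v\<in>Basis. g (0, v))"
proof -
  have "inj_on (\<lambda>u. (u::'a, 0::'b)) Basis" "inj_on (\<lambda>u. (0::'a, u::'b)) Basis"
    by (auto intro!: inj_onI)
  then show ?thesis
    unfolding Basis_prod_def
    by (subst sum.union_disjoint) (auto simp: sum.reindex)
qed

lemma sum_Basis_vec:
  fixes g :: "real ^ 'n::finite \<Rightarrow> 'a::comm_monoid_add"
  shows "sum g Basis = (\<Sum>a\<in>UNIV. g (axis a 1))"
proof -
  have B: "(Basis :: (real ^ 'n) set) = range (\<lambda>a. axis a 1)"
    by (auto simp: Basis_vec_def)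
  have "inj (\<lambda>a::'n. axis a (1::real))"
    by (auto intro!: injI simp: axis_eq_axis)
  then show ?thesis
    unfolding B by (simp add: sum.reindex)
qed

lemma sum_mult_axis: "(\<Sum>b\<in>UNIV. c b * axis a (1::real) $ b) = c a"
  for a :: "'n::finite" and c :: "'n \<Rightarrow> real"
proof -
  have "(\<Sum>b\<in>UNIV. c b * axis a (1::real) $ b) = (\<Sum>b\<in>UNIV. if b = a then c b else 0)"
    by (intro sum.cong refl) (auto simp: axis_def)
  then show ?thesis by simp
qed

lemma sum_axis_mult: "(\<Sum>b\<in>UNIV. axis a (1::real) $ b * c b) = c a"
  for a :: "'n::finite" and c :: "'n \<Rightarrow> real"
  using sum_mult_axis[of c a] by (simp add: mult.commute)

lemma bounded_linear_momentum: "bounded_linear (\<lambda>y. fst (snd y))"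
  by (intro bounded_linear_compose[OF bounded_linear_fst bounded_linear_snd])

text \<open>The closure rules for \<open>smooth_on\<close> require an open domain, here the set of
  momenta occurring in \<open>U\<close>; projections are open maps.\<close>

lemma open_momentum_image: "open U \<Longrightarrow> open ((\<lambda>y. fst (snd y)) ` U)"
  using open_image_fst[OF open_image_snd] by (metis image_image)

text \<open>The Hamiltonian of the theorem has this shape with $G_a = F_a + \gamma^0 p_a$ and
  $K = F_a\,\partial\varphi/\partial p_a + \gamma^0\varphi$. As it is affine in \<open>x\<close> and \<open>z\<close>, the
  divergence of its field is computed without the symmetry of second derivatives.\<close>
locale affine_contact_hamiltonian =
  fixes U :: "'n::finite contact_space set"
    and K :: "real ^ 'n \<Rightarrow> real"
    and G :: "'n \<Rightarrow> real ^ 'n \<Rightarrow> real"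
    and c :: real
    and h :: "'n contact_space \<Rightarrow> real"
    and X :: "'n contact_space \<Rightarrow> 'n contact_space"
  assumes open_U: "open U"
    and smooth_K: "smooth_on ((\<lambda>y. fst (snd y)) ` U) K"
    and smooth_G: "\<And>a. smooth_on ((\<lambda>y. fst (snd y)) ` U) (G a)"
    and h_eq: "\<And>x p z. (x, p, z) \<in> U \<Longrightarrow> h (x, p, z) = (\<Sum>a\<in>UNIV. x $ a * G a p) - K p - c * z"
    and field_X: "contact_hamiltonian_field U h X"
begin

abbreviation (input) P :: "(real ^ 'n) set" where "P \<equiv> (\<lambda>y. fst (snd y)) ` U"

definition h_deriv :: "'n contact_space \<Rightarrow> 'n contact_space \<Rightarrow> real" where
  "h_deriv y u = (\<Sum>a\<in>UNIV. fst y $ a * frechet_derivative (G a) (at (fst (snd y))) (fst (snd u))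
      + fst u $ a * G a (fst (snd y)))
    - frechet_derivative K (at (fst (snd y))) (fst (snd u)) - c * snd (snd u)"

lemma has_derivative_comp_momentum:
  assumes "smooth_on P f" "y \<in> U"
  shows "((\<lambda>y. f (fst (snd y))) has_derivative
    (\<lambda>u. frechet_derivative f (at (fst (snd y))) (fst (snd u)))) (at y)"
  by (rule has_derivative_compose[OF bounded_linear_imp_has_derivative[OF bounded_linear_momentum]
        smooth_on_has_derivative[OF assms(1)]]) (use assms(2) in auto)

lemma has_derivative_position: "((\<lambda>y. fst y $ a) has_derivative (\<lambda>u. fst u $ a)) F"
  for a :: 'n
  by (intro bounded_linear_imp_has_derivative bounded_linear_compose[OF bounded_linear_vec_nth bounded_linear_fst])

lemma has_derivative_h: "y \<in> U \<Longrightarrow> (h has_derivative h_deriv y) (at y)"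
proof (rule has_derivative_transform_within_open[OF _ open_U])
  assume y: "y \<in> U"
  show "((\<lambda>y. (\<Sum>a\<in>UNIV. fst y $ a * G a (fst (snd y))) - K (fst (snd y)) - c * snd (snd y))
      has_derivative h_deriv y) (at y)"
    unfolding h_deriv_def[abs_def]
    by (intro has_derivative_diff has_derivative_sum has_derivative_mult has_derivative_position
        has_derivative_comp_momentum smooth_K smooth_G y has_derivative_mult_right has_derivative_snd
        has_derivative_ident)
qed (auto simp: h_eq)

lemma smooth_h: "smooth_on U h"
proof (rule smooth_on_cong[OF open_U])
  show "smooth_on U (\<lambda>y. (\<Sum>a\<in>UNIV. fst y $ a * G a (fst (snd y))) - K (fst (snd y)) - c * snd (snd y))"
    by (intro smooth_on_diff smooth_on_sum smooth_on_mult smooth_on_const open_U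
        smooth_on_compose_linear[OF open_U bounded_linear_momentum order_refl] smooth_K smooth_G
        smooth_on_bounded_linear bounded_linear_compose[OF bounded_linear_vec_nth bounded_linear_fst]
        bounded_linear_compose[OF bounded_linear_snd bounded_linear_snd])
qed (auto simp: h_eq)

text \<open>This is -\<partial>h/\<partial>p_a. It does not involve z, so in the z-component
  \<open>h\<close> + p_a \<open>x_dot\<close> of the field only \<open>h\<close> has a
  z-derivative.\<close>

definition x_dot :: "'n \<Rightarrow> 'n contact_space \<Rightarrow> real" where
  "x_dot a y = partial_deriv a K (fst (snd y)) - (\<Sum>b\<in>UNIV. fst y $ b * partial_deriv a (G b) (fst (snd y)))"

definition x_dot_deriv :: "'n \<Rightarrow> 'n contact_space \<Rightarrow> 'n contact_space \<Rightarrow> real" where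
  "x_dot_deriv a y u = frechet_derivative (partial_deriv a K) (at (fst (snd y))) (fst (snd u))
    - (\<Sum>b\<in>UNIV. fst y $ b * frechet_derivative (partial_deriv a (G b)) (at (fst (snd y))) (fst (snd u))
        + fst u $ b * partial_deriv a (G b) (fst (snd y)))"

lemma has_derivative_x_dot: "y \<in> U \<Longrightarrow> (x_dot a has_derivative x_dot_deriv a y) (at y)"
  unfolding x_dot_def[abs_def] x_dot_deriv_def[abs_def] partial_deriv_def[abs_def]
  by (intro has_derivative_diff has_derivative_sum has_derivative_mult has_derivative_position
      has_derivative_comp_momentum smooth_on_frechet_derivative smooth_K smooth_G)

lemma frechet_derivative_h: "y \<in> U \<Longrightarrow> frechet_derivative h (at y) = h_deriv y"
  by (rule frechet_derivative_at[OF has_derivative_h, symmetric])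

lemma linear_frechet_K: "y \<in> U \<Longrightarrow> linear (frechet_derivative K (at (fst (snd y))))"
  by (rule has_derivative_linear[OF smooth_on_has_derivative[OF smooth_K]]) auto

lemma linear_frechet_G: "y \<in> U \<Longrightarrow> linear (frechet_derivative (G a) (at (fst (snd y))))"
  by (rule has_derivative_linear[OF smooth_on_has_derivative[OF smooth_G]]) auto

lemma field_eq:
  assumes y: "y \<in> U"
  shows "X y = (\<chi> a. x_dot a y, \<chi> a. G a (fst (snd y)) - c * fst (snd y) $ a,
    h y + (\<Sum>a\<in>UNIV. fst (snd y) $ a * x_dot a y))"
proof -
  obtain x p z where xyz: "y = (x, p, z)" by (cases y)
  have "X (x, p, z) = (- (\<chi> a. h_deriv y (0, axis a 1, 0)), (\<chi> a. h_deriv y (axis a 1, 0, 0)) + h_deriv y (0, 0, 1) *\<^sub>R p,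
      h (x, p, z) - (\<Sum>a\<in>UNIV. p $ a * h_deriv y (0, axis a 1, 0)))"
    using contact_hamiltonian_field_coords[of U h X] has_derivative_h field_X y frechet_derivative_h[OF y]
    unfolding xyz by (fastforce simp: Let_def differentiable_def)
  moreover have "h_deriv y (0, axis a 1, 0) = - x_dot a y" for a
    by (simp add: h_deriv_def x_dot_def partial_deriv_def)
  moreover have "h_deriv y (axis a 1, 0, 0) = G a p" for a
    using linear_0[OF linear_frechet_K[OF y]] linear_0[OF linear_frechet_G[OF y]]
    by (simp add: h_deriv_def xyz sum_axis_mult)
  moreover have "h_deriv y (0, 0, 1) = - c"
    using linear_0[OF linear_frechet_K[OF y]] linear_0[OF linear_frechet_G[OF y]]
    by (simp add: h_deriv_def)
  ultimately show ?thesis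
    by (simp add: xyz vec_eq_iff sum_negf)
qed

definition X_deriv :: "'n contact_space \<Rightarrow> 'n contact_space \<Rightarrow> 'n contact_space" where
  "X_deriv y u = (\<chi> a. x_dot_deriv a y u,
    \<chi> a. frechet_derivative (G a) (at (fst (snd y))) (fst (snd u)) - c * fst (snd u) $ a,
    h_deriv y u + (\<Sum>a\<in>UNIV. fst (snd y) $ a * x_dot_deriv a y u + fst (snd u) $ a * x_dot a y))"

lemma has_derivative_field:
  assumes y: "y \<in> U"
  shows "(X has_derivative X_deriv y) (at y)"
proof (rule has_derivative_transform_within_open[OF _ open_U y])
  have p: "((\<lambda>y. fst (snd y) $ a) has_derivative (\<lambda>u. fst (snd u) $ a)) F" for F and a :: 'n
    by (intro bounded_linear_imp_has_derivative bounded_linear_compose[OF bounded_linear_vec_nth bounded_linear_momentum])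
  show "((\<lambda>y. (\<chi> a. x_dot a y, \<chi> a. G a (fst (snd y)) - c * fst (snd y) $ a,
      h y + (\<Sum>a\<in>UNIV. fst (snd y) $ a * x_dot a y))) has_derivative X_deriv y) (at y)"
    unfolding X_deriv_def[abs_def]
    by (intro has_derivative_Pair has_derivative_vec_lambda has_derivative_x_dot y has_derivative_diff
        has_derivative_comp_momentum smooth_G p has_derivative_mult_right has_derivative_add
        has_derivative_h has_derivative_sum has_derivative_mult)
qed (simp add: field_eq)

text \<open>The x-block contributes minus the sum of \<partial>G_a/\<partial>p_a, the p-block the
  same sum with a plus sign and -n\<open>c\<close>, and the z-block -\<open>c\<close>.\<close>

lemma divergence_field:
  assumes y: "y \<in> U"
  shows "(\<Sum>e\<in>Basis. X_deriv y e \<bullet> e) = - (real CARD('n) + 1) * c"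
proof -
  note K0 = linear_0[OF linear_frechet_K[OF y]] and G0 = linear_0[OF linear_frechet_G[OF y]]
  have lin: "linear (frechet_derivative (partial_deriv a f) (at (fst (snd y))))" if "smooth_on P f" for a f
    unfolding partial_deriv_def[abs_def]
    by (rule has_derivative_linear[OF smooth_on_has_derivative[OF smooth_on_frechet_derivative[OF that]]])
      (use y in auto)
  note K0' = linear_0[OF lin[OF smooth_K]] and G0' = linear_0[OF lin[OF smooth_G]]
  have "x_dot_deriv a y (axis a 1, 0) = - partial_deriv a (G a) (fst (snd y))"
    and "x_dot_deriv a y (0, 0, 1) = 0" for a
    by (simp_all add: x_dot_deriv_def K0' G0' sum_axis_mult)
  moreover have "h_deriv y (0, 0, 1) = - c"
    by (simp add: h_deriv_def K0 G0)
  ultimately show ?thesis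
    by (simp add: sum_Basis_prod sum_Basis_vec X_deriv_def inner_axis partial_deriv_def sum_subtractf sum_negf algebra_simps)
qed

lemma reeb_deriv_h: "y \<in> U \<Longrightarrow> reeb_deriv h y = - c"
  using linear_0[OF linear_frechet_K] linear_0[OF linear_frechet_G]
  by (simp add: reeb_deriv_def frechet_derivative_h h_deriv_def)

lemma h_deriv_field: "y \<in> U \<Longrightarrow> h_deriv y (X y) = - c * h y"
  using contact_hamiltonian_field_derivative[OF field_X] by (simp add: reeb_deriv_h frechet_derivative_h)

lemma open_pos: "open {y \<in> U. h y > 0}"
  using continuous_open_preimage[OF smooth_on_imp_continuous_on[OF smooth_h] open_U open_greaterThan[of 0]]
  by (simp add: vimage_def greaterThan_def Int_def)

lemma smooth_h_pos: "smooth_on {y \<in> U. h y > 0} h"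
  by (rule smooth_on_subset[OF smooth_h]) auto

end

section \<open>The invariant density\<close>

theorem theorem4p2:
  fixes U :: "'n::finite contact_space set"
    and \<phi> :: "real ^ 'n \<Rightarrow> real"
    and F :: "'n \<Rightarrow> real ^ 'n \<Rightarrow> real"
    and \<gamma>0 Z :: real
    and h :: "'n contact_space \<Rightarrow> real"
    and X :: "'n contact_space \<Rightarrow> 'n contact_space"
  assumes "open U"
    and "smooth_on ((\<lambda>(x, p, z). p) ` U) \<phi>"
    and "\<And>a. smooth_on ((\<lambda>(x, p, z). p) ` U) (F a)"
    and "\<And>a. \<exists>p\<in>(\<lambda>(x, p, z). p) ` U. F a p \<noteq> 0"
    and "\<gamma>0 \<noteq> 0"
    and "\<And>x p z. (x, p, z) \<in> U \<Longrightarrow> h (x, p, z) =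
           (\<Sum>a\<in>UNIV. (x $ a - partial_deriv a \<phi> p) * F a p)
           + \<gamma>0 * ((\<Sum>j\<in>UNIV. x $ j * p $ j) - \<phi> p - z)"
    and "contact_hamiltonian_field U h X"
    and "Z \<noteq> 0"
  defines "f_inv \<equiv> (\<lambda>y. 1 / Z * h y powi (- int (CARD('n) + 1)))"
  shows "(\<exists>\<rho>. smooth_on {0<..} \<rho> \<and> (\<forall>y\<in>{y \<in> U. h y > 0}. f_inv y = \<rho> (h y))) \<and>
    invariant_measure {y \<in> U. h y > 0} X (\<lambda>t y v. f_inv y * contact_volume y v)"
proof
  let ?m = "- int (CARD('n) + 1)"
  let ?S = "{y \<in> U. h y > 0}"
  have "smooth_on {0<..} (\<lambda>s::real. 1 / Z * s powi ?m)"
    by (intro smooth_on_mult smooth_on_const smooth_on_powi smooth_on_bounded_linear bounded_linear_ident) auto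
  then show "\<exists>\<rho>. smooth_on {0<..} \<rho> \<and> (\<forall>y\<in>?S. f_inv y = \<rho> (h y))"
    by (intro exI[of _ "\<lambda>s. 1 / Z * s powi ?m"]) (simp add: f_inv_def)
  have P: "(\<lambda>(x, p, z). p) ` U = (\<lambda>y. fst (snd y)) ` U"
    by (simp add: case_prod_beta)
  note P_open = open_momentum_image[OF \<open>open U\<close>]
  note \<phi> = assms(2)[unfolded P] and F = assms(3)[unfolded P]
  interpret affine_contact_hamiltonian U
    "\<lambda>p. (\<Sum>a\<in>UNIV. partial_deriv a \<phi> p * F a p) + \<gamma>0 * \<phi> p" "\<lambda>a p. F a p + \<gamma>0 * p $ a" \<gamma>0 h X
  proof
    show "smooth_on ((\<lambda>y. fst (snd y)) ` U) (\<lambda>p. (\<Sum>a\<in>UNIV. partial_deriv a \<phi> p * F a p) + \<gamma>0 * \<phi> p)"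
      unfolding partial_deriv_def
      by (intro smooth_on_add smooth_on_sum smooth_on_mult smooth_on_const smooth_on_frechet_derivative P_open \<phi> F)
    show "smooth_on ((\<lambda>y. fst (snd y)) ` U) (\<lambda>p. F a p + \<gamma>0 * p $ a)" for a
      by (intro smooth_on_add smooth_on_mult smooth_on_const P_open F smooth_on_bounded_linear
          bounded_linear_vec_nth)
    show "h (x, p, z) = (\<Sum>a\<in>UNIV. x $ a * (F a p + \<gamma>0 * p $ a))
        - ((\<Sum>a\<in>UNIV. partial_deriv a \<phi> p * F a p) + \<gamma>0 * \<phi> p) - \<gamma>0 * z" if "(x, p, z) \<in> U" for x p z
      unfolding assms(6)[OF that]
      by (simp add: algebra_simps sum.distrib sum_subtractf sum_distrib_left)
  qed fact+
  \<comment> \<open>Freezing the volume form at the origin exhibits it as a form with constant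
    coefficients, as \<open>lie_derivative_density\<close> expects.\<close>
  define \<omega> where "\<omega> = contact_volume (0 :: 'n contact_space)"
  have \<omega>: "alternating_form DIM('n contact_space) \<omega>" and cv: "contact_volume y v = \<omega> v" for y v
    using alternating_contact_volume[of 0] contact_volume_eq_at_0[of y v] by (simp_all only: \<omega>_def)
  have smooth_f: "smooth_on ?S f_inv"
    unfolding f_inv_def
    by (intro smooth_on_mult smooth_on_const smooth_on_powi open_pos smooth_h_pos) auto
  show "invariant_measure ?S X (\<lambda>t y v. f_inv y * contact_volume y v)"
    unfolding invariant_measure_def diff_form_on_def cv
  proof (intro allI conjI ballI)
    show "alternating_form DIM('n contact_space) (\<lambda>v. f_inv y * \<omega> v)" for y
      by (rule alternating_form_cmult[OF \<omega>])
    show "smooth_on ?S (\<lambda>y. f_inv y * \<omega> v)" for v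
      by (intro smooth_on_mult smooth_on_const open_pos smooth_f)
    show "\<exists>v. f_inv y * \<omega> v \<noteq> 0" if "y \<in> ?S" for y
      using contact_volume_nonzero[of y] that \<open>Z \<noteq> 0\<close> by (simp add: cv f_inv_def)
    show "((\<lambda>s. f_inv y * \<omega> v) has_real_derivative 0) (at t)" for y v and t :: real
      by (rule DERIV_const)
    show "lie_derivative DIM('n contact_space) X (\<lambda>y v. f_inv y * \<omega> v) y v = 0" if "y \<in> ?S" for y v
    proof -
      have y: "y \<in> U" "h y > 0" using that by auto
      \<comment> \<open>The exponent is negative, so the power rule relies on \<open>h y\<close>
        being non-zero, which holds on the region of positive \<open>h\<close>.\<close>
      have "(f_inv has_derivative (\<lambda>u. 1 / Z * (h_deriv y u * (of_int ?m * h y powi (?m - 1))))) (at y)"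
        unfolding f_inv_def
        by (intro has_derivative_mult_right has_derivative_power_int has_derivative_h y) (use y in simp)
      from lie_derivative_density[OF \<omega> this has_derivative_field[OF y(1)], of v]
      have "lie_derivative DIM('n contact_space) X (\<lambda>y v. f_inv y * \<omega> v) y v =
          (1 / Z * ((- \<gamma>0 * h y) * (of_int ?m * h y powi (?m - 1))) + f_inv y * (- (real CARD('n) + 1) * \<gamma>0)) * \<omega> v"
        unfolding divergence_field[OF y(1)] h_deriv_field[OF y(1)] mult.assoc .
      \<comment> \<open>One factor \<open>h y\<close> is split off to match the one supplied by the
        derivative of \<open>h\<close> along \<open>X\<close>. The two terms are then (n + 1)
        \<open>\<gamma>0\<close> \<open>f_inv y\<close> with opposite signs.\<close>
      moreover have "f_inv y = 1 / Z * (h y powi (?m - 1) * h y)"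
        using power_int_add_1[of "h y" "?m - 1"] y(2) by (simp only: f_inv_def diff_add_cancel) simp
      ultimately show ?thesis
        using \<open>Z \<noteq> 0\<close> by (simp add: field_simps)
    qed
  qed
qed

end
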